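(* Let $\mu$ be an absolutely continuous positive NC measure. Then the closure of the positive semi-definite $L$-Toeplitz form $q_\mu$ is the sesquilinear form $q_T(g,h)=\langle\sqrt Tg,\sqrt Th\rangle_{\mathbb H^2_d}$, $g,h\in\mathrm{Dom}\sqrt T$, of a unique closed, positive semi-definite $L$-Toeplitz operator $T$, and $\mathcal A_d$ is a core for $\sqrt T$.
   Context: Fix $d\in\mathbb N$. $\mathbb F^d$ is the free monoid of words in $1,\dots,d$. $\mathbb H^2_d=\ell^2(\mathbb F^d)$ has orthonormal basis $\{e_\alpha\}_{\alpha\in\mathbb F^d}$, and $1:=e_\emptyset$. $L_ke_\alpha=e_{k\alpha}$, $1\le k\le d$, are the left free shifts. $\mathcal A_d$ is the norm-closed unital operator algebra generated by $L_1,\dots,L_d$; $a\in\mathcal A_d$ is identified with $a1\in\mathbb H^2_d$, so that $\mathcal A_d$ is a dense subspace of $\mathbb H^2_d$. $\mathscr A_d$ is the norm closure of $\mathcal A_d+\mathcal A_d^*$; it contains $\mathcal A_d^*\mathcal A_d$. A positive NC measure is a positive linear functional on $\mathscr A_d$. Inner products and sesquilinear forms are conjugate-linear in the first argument. $q_\mu(a_1,a_2)=\mu(a_1^*a_2)$ has dense domain $\mathcal A_d\subset\mathbb H^2_d$. A densely-defined positive semi-definite form $q$ is closed if $\mathrm{Dom}\,q$ is complete in the norm $(q(x,x)+\|x\|^2)^{1/2}$, and closable if it has a closed extension; its closure is then its minimal closed extension. $\mu$ is absolutely continuous if $q_\mu$ is closable. A positive semi-definite form $q$ with dense $L$-invariant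 domain is $L$-Toeplitz if $q(L_jg,L_kh)=\delta_{k,j}q(g,h)$ for all $g,h\in\mathrm{Dom}\,q$. A closed positive semi-definite densely-defined operator means a self-adjoint $T\ge0$; it is $L$-Toeplitz if $\mathrm{Dom}\sqrt T$ is $L$-invariant (invariant under each $L_k$) and $q_T$ is an $L$-Toeplitz form. A subspace $\mathcal D\subseteq\mathrm{Dom}\,A$ is a core for a closed operator $A$ if $\{(x,Ax):x\in\mathcal D\}$ is dense in the graph of $A$. *)

theory Defs
  imports "HOL-Analysis.Analysis"
begin

section \<open>The complex Hilbert space of square-summable families\<close>

typedef 'a ell2 = "{f :: 'a \<Rightarrow> complex. (\<lambda>i. (cmod (f i))\<^sup>2) summable_on UNIV}"
  by (rule exI[of _ "\<lambda>_. 0"]) simp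

setup_lifting type_definition_ell2

lemma sq_summable_add:
  fixes f g :: "'a \<Rightarrow> complex"
  assumes "(\<lambda>i. (cmod (f i))\<^sup>2) summable_on A" "(\<lambda>i. (cmod (g i))\<^sup>2) summable_on A"
  shows "(\<lambda>i. (cmod (f i + g i))\<^sup>2) summable_on A"
proof (rule summable_on_comparison_test)
  show "(\<lambda>i. 2 * (cmod (f i))\<^sup>2 + 2 * (cmod (g i))\<^sup>2) summable_on A"
    using assms by (intro summable_on_add summable_on_cmult_right)
  fix i
  have "(cmod (f i + g i))\<^sup>2 \<le> (cmod (f i) + cmod (g i))\<^sup>2"
    by (simp add: norm_triangle_ineq power_mono)
  also have "\<dots> \<le> 2 * (cmod (f i))\<^sup>2 + 2 * (cmod (g i))\<^sup>2"
    using zero_le_power2[of "cmod (f i) - cmod (g i)"] by (simp add: power2_eq_square algebra_simps)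
  finally show "(cmod (f i + g i))\<^sup>2 \<le> 2 * (cmod (f i))\<^sup>2 + 2 * (cmod (g i))\<^sup>2" .
qed auto

lemma sq_summable_scale:
  fixes f :: "'a \<Rightarrow> complex"
  assumes "(\<lambda>i. (cmod (f i))\<^sup>2) summable_on A"
  shows "(\<lambda>i. (cmod (c * f i))\<^sup>2) summable_on A"
  using summable_on_cmult_right[OF assms, of "(cmod c)\<^sup>2"] by (simp add: norm_mult power_mult_distrib)

lemma sq_summable_mult:
  fixes f g :: "'a \<Rightarrow> complex"
  assumes "(\<lambda>i. (cmod (f i))\<^sup>2) summable_on A" "(\<lambda>i. (cmod (g i))\<^sup>2) summable_on A"
  shows "(\<lambda>i. cnj (f i) * g i) summable_on A"
proof (rule abs_summable_summable, rule summable_on_comparison_test)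
  show "(\<lambda>i. (cmod (f i))\<^sup>2 + (cmod (g i))\<^sup>2) summable_on A"
    using assms by (intro summable_on_add)
  fix i
  have "2 * (cmod (f i) * cmod (g i)) \<le> (cmod (f i))\<^sup>2 + (cmod (g i))\<^sup>2"
    using zero_le_power2[of "cmod (f i) - cmod (g i)"] by (simp add: power2_eq_square algebra_simps)
  moreover have "0 \<le> cmod (f i) * cmod (g i)" by simp
  ultimately show "cmod (cnj (f i) * g i) \<le> (cmod (f i))\<^sup>2 + (cmod (g i))\<^sup>2"
    unfolding norm_mult complex_mod_cnj by linarith
qed auto

lift_definition scaleC :: "complex \<Rightarrow> 'a ell2 \<Rightarrow> 'a ell2" is "\<lambda>c f i. c * f i"
  by (rule sq_summable_scale)

lift_definition cinner :: "'a ell2 \<Rightarrow> 'a ell2 \<Rightarrow> complex"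
  is "\<lambda>f g. \<Sum>\<^sub>\<infinity>i. cnj (f i) * g i" .

lift_definition ell2_basis :: "'a \<Rightarrow> 'a ell2" is "\<lambda>i j. of_bool (j = i)"
proof -
  fix i :: 'a
  have "(\<lambda>j. (cmod (of_bool (j = i)))\<^sup>2) summable_on {i}" by simp
  then show "(\<lambda>j. (cmod (of_bool (j = i)))\<^sup>2) summable_on UNIV"
    by (subst summable_on_cong_neutral[where T = "{i}"]) auto
qed

lemma cinner_self: "cinner x x = of_real (\<Sum>\<^sub>\<infinity>i. (cmod (Rep_ell2 x i))\<^sup>2)"
proof -
  have "(\<Sum>\<^sub>\<infinity>i. cnj (Rep_ell2 x i) * Rep_ell2 x i) = (\<Sum>\<^sub>\<infinity>i. of_real ((cmod (Rep_ell2 x i))\<^sup>2))"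
    by (intro infsum_cong) (metis complex_norm_square mult.commute)
  also have "\<dots> = of_real (\<Sum>\<^sub>\<infinity>i. (cmod (Rep_ell2 x i))\<^sup>2)"
    using Rep_ell2[of x] by (intro infsumI has_sum_of_real has_sum_infsum) simp
  finally show ?thesis by (simp add: cinner.rep_eq)
qed

instantiation ell2 :: (type) real_vector
begin

lift_definition zero_ell2 :: "'a ell2" is "\<lambda>_. 0" by simp

lift_definition plus_ell2 :: "'a ell2 \<Rightarrow> 'a ell2 \<Rightarrow> 'a ell2" is "\<lambda>f g i. f i + g i"
  by (rule sq_summable_add)

lift_definition uminus_ell2 :: "'a ell2 \<Rightarrow> 'a ell2" is "\<lambda>f i. - f i" by simp

lift_definition minus_ell2 :: "'a ell2 \<Rightarrow> 'a ell2 \<Rightarrow> 'a ell2" is "\<lambda>f g i. f i - g i"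
  using sq_summable_add[where g = "\<lambda>i. - g i" for g] by fastforce

lift_definition scaleR_ell2 :: "real \<Rightarrow> 'a ell2 \<Rightarrow> 'a ell2" is "\<lambda>r f i. of_real r * f i"
  by (rule sq_summable_scale)

instance
proof
  fix x y z :: "'a ell2" and r s :: real
  show "x + y + z = x + (y + z)" "x + y = y + x" "0 + x = x" "- x + x = 0" "x - y = x + - y"
    by (transfer, auto)+
  show "r *\<^sub>R (x + y) = r *\<^sub>R x + r *\<^sub>R y" "(r + s) *\<^sub>R x = r *\<^sub>R x + s *\<^sub>R x"
    "r *\<^sub>R s *\<^sub>R x = (r * s) *\<^sub>R x" "1 *\<^sub>R x = x"
    by (transfer, auto simp: algebra_simps)+
qed

end

instantiation ell2 :: (type) real_inner
begin

definition inner_ell2 :: "'a ell2 \<Rightarrow> 'a ell2 \<Rightarrow> real"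
  where "inner_ell2 x y = Re (cinner x y)"

definition norm_ell2 :: "'a ell2 \<Rightarrow> real"
  where "norm_ell2 x = sqrt (\<Sum>\<^sub>\<infinity>i. (cmod (Rep_ell2 x i))\<^sup>2)"

definition sgn_ell2 :: "'a ell2 \<Rightarrow> 'a ell2"
  where "sgn_ell2 x = x /\<^sub>R norm x"

definition dist_ell2 :: "'a ell2 \<Rightarrow> 'a ell2 \<Rightarrow> real"
  where "dist_ell2 x y = norm (x - y)"

definition uniformity_ell2 :: "('a ell2 \<times> 'a ell2) filter"
  where "uniformity_ell2 = (INF e\<in>{0<..}. principal {(x, y). dist x y < e})"

definition open_ell2 :: "'a ell2 set \<Rightarrow> bool"
  where "open_ell2 U \<longleftrightarrow> (\<forall>x\<in>U. eventually (\<lambda>(x', y). x' = x \<longrightarrow> y \<in> U) uniformity)"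

instance
proof
  fix x y z :: "'a ell2" and r :: real
  show "sgn x = x /\<^sub>R norm x" by (rule sgn_ell2_def)
  show "dist x y = norm (x - y)" by (rule dist_ell2_def)
  show "uniformity = (INF e\<in>{0<..}. principal {(x :: 'a ell2, y). dist x y < e})"
    by (rule uniformity_ell2_def)
  show "inner x y = inner y x"
  proof -
    have "cinner x y = cnj (cinner y x)"
      by transfer (simp flip: infsum_cnj add: mult.commute)
    then show ?thesis by (simp add: inner_ell2_def)
  qed
  show "inner (x + y) z = inner x z + inner y z"
  proof -
    have "cinner (x + y) z = cinner x z + cinner y z"
      by transfer (simp add: distrib_right infsum_add sq_summable_mult)
    then show ?thesis by (simp add: inner_ell2_def)
  qed
  show "inner (r *\<^sub>R x) y = r * inner x y"
  proof -
    have "cinner (r *\<^sub>R x) y = of_real r * cinner x y"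
      by transfer (simp add: mult.assoc infsum_cmult_right')
    then show ?thesis by (simp add: inner_ell2_def)
  qed
  show "0 \<le> inner x x" by (simp add: inner_ell2_def cinner_self infsum_nonneg)
  show "inner x x = 0 \<longleftrightarrow> x = 0"
  proof
    assume "inner x x = 0"
    then have 0: "(\<Sum>\<^sub>\<infinity>i. (cmod (Rep_ell2 x i))\<^sup>2) \<le> 0"
      by (simp add: inner_ell2_def cinner_self)
    have "(cmod (Rep_ell2 x i))\<^sup>2 = 0" for i
      by (rule nonneg_infsum_le_0D[OF 0]) (use Rep_ell2[of x] in auto)
    then show "x = 0" by (simp flip: Rep_ell2_inject add: zero_ell2.rep_eq fun_eq_iff)
  next
    assume "x = 0"
    then show "inner x x = 0" by (simp add: inner_ell2_def cinner_self zero_ell2.rep_eq)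
  qed
  show "norm x = sqrt (inner x x)" by (simp add: norm_ell2_def inner_ell2_def cinner_self)
next
  fix U :: "'a ell2 set"
  show "open U \<longleftrightarrow> (\<forall>x\<in>U. eventually (\<lambda>(x', y). x' = x \<longrightarrow> y \<in> U) uniformity)"
    by (rule open_ell2_def)
qed

end

definition csubspace :: "'a ell2 set \<Rightarrow> bool" where
  "csubspace D \<longleftrightarrow> 0 \<in> D \<and> (\<forall>x\<in>D. \<forall>y\<in>D. x + y \<in> D) \<and> (\<forall>c. \<forall>x\<in>D. scaleC c x \<in> D)"


section \<open>Bounded operators\<close>

text \<open>Bounded operators are elements of \<^typ>\<open>'a ell2 \<Rightarrow>\<^sub>L 'a ell2\<close>, with its operator norm. That type
  only enforces real linearity, but every operator used below is complex linear.\<close>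

type_synonym 'a bop = "'a ell2 \<Rightarrow>\<^sub>L 'a ell2"

lemma norm_scaleC: "norm (scaleC c x) = cmod c * norm x"
proof -
  have "(\<Sum>\<^sub>\<infinity>i. (cmod (c * Rep_ell2 x i))\<^sup>2) = (cmod c)\<^sup>2 * (\<Sum>\<^sub>\<infinity>i. (cmod (Rep_ell2 x i))\<^sup>2)"
    by (simp add: norm_mult power_mult_distrib infsum_cmult_right')
  then show ?thesis by (simp add: norm_ell2_def scaleC.rep_eq real_sqrt_mult)
qed

lift_definition scaleC_op :: "complex \<Rightarrow> 'a bop" is scaleC
proof (rule bounded_linear_intro[where K = "cmod c" for c])
  fix c :: complex and x y :: "'a ell2" and r :: real
  show "scaleC c (x + y) = scaleC c x + scaleC c y" by transfer (simp add: distrib_left)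
  show "scaleC c (r *\<^sub>R x) = r *\<^sub>R scaleC c x" by transfer (simp add: mult.left_commute)
  show "norm (scaleC c x) \<le> norm x * cmod c" by (simp add: norm_scaleC)
qed

definition adj :: "'a bop \<Rightarrow> 'a bop" where
  "adj A = (THE B. \<forall>x y. cinner (blinfun_apply B x) y = cinner x (blinfun_apply A y))"

definition positive_bop :: "'a bop \<Rightarrow> bool" where
  "positive_bop A \<longleftrightarrow> (\<forall>x. cinner x (blinfun_apply A x) \<in> \<real>\<^sub>\<ge>\<^sub>0)"


section \<open>The free disk system\<close>

text \<open>The alphabet \<open>1, \<dots>, d\<close> is a finite type \<open>'d\<close>, the free monoid is \<^typ>\<open>'d list\<close>, and the
  Hilbert space is \<^typ>\<open>'d list ell2\<close>.\<close>

lift_definition shift_fun :: "'d \<Rightarrow> 'd list ell2 \<Rightarrow> 'd list ell2"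
  is "\<lambda>k f w. case w of [] \<Rightarrow> 0 | j # v \<Rightarrow> if j = k then f v else 0"
proof -
  fix k :: 'd and f :: "'d list \<Rightarrow> complex"
  let ?g = "\<lambda>w. case w of [] \<Rightarrow> 0 | j # v \<Rightarrow> if j = k then f v else 0"
  assume "(\<lambda>i. (cmod (f i))\<^sup>2) summable_on UNIV"
  then have "(\<lambda>w. (cmod (?g w))\<^sup>2) summable_on range (Cons k)"
    by (subst summable_on_reindex) (auto simp: o_def)
  then show "(\<lambda>w. (cmod (?g w))\<^sup>2) summable_on UNIV"
    by (subst summable_on_cong_neutral[where T = "range (Cons k)"]) (auto split: list.splits)
qed

lemma norm_shift_fun: "norm (shift_fun k x) = norm x"
proof -
  let ?f = "Rep_ell2 x"
  let ?g = "\<lambda>w. case w of [] \<Rightarrow> 0 | j # v \<Rightarrow> if j = k then ?f v else 0"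
  have "(\<Sum>\<^sub>\<infinity>w. (cmod (?g w))\<^sup>2) = (\<Sum>\<^sub>\<infinity>w\<in>range (Cons k). (cmod (?g w))\<^sup>2)"
    by (rule infsum_cong_neutral) (auto split: list.splits)
  also have "\<dots> = (\<Sum>\<^sub>\<infinity>w. (cmod (?f w))\<^sup>2)"
    by (subst infsum_reindex) (auto simp: o_def)
  finally show ?thesis by (simp add: norm_ell2_def shift_fun.rep_eq)
qed

lift_definition Lshift :: "'d \<Rightarrow> 'd list bop" is shift_fun
proof (rule bounded_linear_intro[where K = 1])
  fix k :: 'd and x y :: "'d list ell2" and r :: real
  show "shift_fun k (x + y) = shift_fun k x + shift_fun k y"
    by transfer (auto split: list.splits)
  show "shift_fun k (r *\<^sub>R x) = r *\<^sub>R shift_fun k x"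
    by transfer (auto split: list.splits)
  show "norm (shift_fun k x) \<le> norm x * 1" by (simp add: norm_shift_fun)
qed

lemma Lshift_basis: "blinfun_apply (Lshift k) (ell2_basis w) = ell2_basis (k # w)"
  unfolding Rep_ell2_inject[symmetric]
  by (auto simp: fun_eq_iff Lshift.rep_eq shift_fun.rep_eq ell2_basis.rep_eq split: list.splits)

inductive_set free_polys :: "'d::finite list bop set" where
  one: "id_blinfun \<in> free_polys"
| shift: "Lshift k \<in> free_polys"
| add: "A \<in> free_polys \<Longrightarrow> B \<in> free_polys \<Longrightarrow> A + B \<in> free_polys"
| scale: "A \<in> free_polys \<Longrightarrow> scaleC_op c o\<^sub>L A \<in> free_polys"
| mult: "A \<in> free_polys \<Longrightarrow> B \<in> free_polys \<Longrightarrow> A o\<^sub>L B \<in> free_polys"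

definition disk_algebra :: "'d::finite list bop set" where
  "disk_algebra = closure free_polys"

definition disk_system :: "'d::finite list bop set" where
  "disk_system = closure {A + adj B | A B. A \<in> disk_algebra \<and> B \<in> disk_algebra}"

definition vac :: "'d list ell2" where
  "vac = ell2_basis []"

definition disk_vecs :: "'d::finite list ell2 set" where
  "disk_vecs = (\<lambda>A. blinfun_apply A vac) ` disk_algebra"

text \<open>The inverse of the identification of \<open>a\<close> with \<open>a 1\<close>, which is injective on the disk algebra.\<close>

definition disk_op :: "'d::finite list ell2 \<Rightarrow> 'd list bop" where
  "disk_op = inv_into disk_algebra (\<lambda>A. blinfun_apply A vac)"

text \<open>Only the values of the functional on \<^const>\<open>disk_system\<close> matter.\<close>

definition positive_nc_measure :: "('d::finite list bop \<Rightarrow> complex) \<Rightarrow> bool" where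
  "positive_nc_measure \<mu> \<longleftrightarrow>
     (\<forall>A\<in>disk_system. \<forall>B\<in>disk_system. \<mu> (A + B) = \<mu> A + \<mu> B) \<and>
     (\<forall>c. \<forall>A\<in>disk_system. \<mu> (scaleC_op c o\<^sub>L A) = c * \<mu> A) \<and>
     (\<forall>A\<in>disk_system. positive_bop A \<longrightarrow> \<mu> A \<in> \<real>\<^sub>\<ge>\<^sub>0)"


section \<open>Sesquilinear forms\<close>

text \<open>A form is a domain together with a function; values off the domain are irrelevant.\<close>

datatype 'a sform = Form (fdom: "'a ell2 set") (fval: "'a ell2 \<Rightarrow> 'a ell2 \<Rightarrow> complex")

definition psd_form :: "'a sform \<Rightarrow> bool" where
  "psd_form q \<longleftrightarrow>
     csubspace (fdom q) \<and> closure (fdom q) = UNIV \<and>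
     (\<forall>x\<in>fdom q. \<forall>y\<in>fdom q. \<forall>z\<in>fdom q.
        fval q (x + y) z = fval q x z + fval q y z \<and> fval q x (y + z) = fval q x y + fval q x z) \<and>
     (\<forall>c. \<forall>x\<in>fdom q. \<forall>y\<in>fdom q.
        fval q (scaleC c x) y = cnj c * fval q x y \<and> fval q x (scaleC c y) = c * fval q x y) \<and>
     (\<forall>x\<in>fdom q. fval q x x \<in> \<real>\<^sub>\<ge>\<^sub>0)"

definition form_norm :: "'a sform \<Rightarrow> 'a ell2 \<Rightarrow> real" where
  "form_norm q x = sqrt (Re (fval q x x) + (norm x)\<^sup>2)"

definition closed_form :: "'a sform \<Rightarrow> bool" where
  "closed_form q \<longleftrightarrow> psd_form q \<and>
     (\<forall>X. (\<forall>n. X n \<in> fdom q) \<and> (\<forall>e>0. \<exists>N. \<forall>m\<ge>N. \<forall>n\<ge>N. form_norm q (X m - X n) < e) \<longrightarrow>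
        (\<exists>x\<in>fdom q. (\<lambda>n. form_norm q (X n - x)) \<longlonglongrightarrow> 0))"

definition form_extends :: "'a sform \<Rightarrow> 'a sform \<Rightarrow> bool" where
  "form_extends r q \<longleftrightarrow>
     fdom q \<subseteq> fdom r \<and> (\<forall>x\<in>fdom q. \<forall>y\<in>fdom q. fval r x y = fval q x y)"

definition closable_form :: "'a sform \<Rightarrow> bool" where
  "closable_form q \<longleftrightarrow> psd_form q \<and> (\<exists>r. closed_form r \<and> form_extends r q)"

definition is_form_closure :: "'a sform \<Rightarrow> 'a sform \<Rightarrow> bool" where
  "is_form_closure q r \<longleftrightarrow> closed_form r \<and> form_extends r q \<and>
     (\<forall>r'. closed_form r' \<and> form_extends r' q \<longrightarrow> form_extends r' r)"

definition L_invariant :: "'d list ell2 set \<Rightarrow> bool" where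
  "L_invariant D \<longleftrightarrow> (\<forall>k. \<forall>x\<in>D. blinfun_apply (Lshift k) x \<in> D)"

definition L_Toeplitz_form :: "'d list sform \<Rightarrow> bool" where
  "L_Toeplitz_form q \<longleftrightarrow> psd_form q \<and> L_invariant (fdom q) \<and>
     (\<forall>j k. \<forall>g\<in>fdom q. \<forall>h\<in>fdom q.
        fval q (blinfun_apply (Lshift j) g) (blinfun_apply (Lshift k) h) =
          (if k = j then fval q g h else 0))"

definition nc_form :: "('d::finite list bop \<Rightarrow> complex) \<Rightarrow> 'd list sform" where
  "nc_form \<mu> = Form disk_vecs (\<lambda>x y. \<mu> (adj (disk_op x) o\<^sub>L disk_op y))"

definition absolutely_continuous_nc :: "('d::finite list bop \<Rightarrow> complex) \<Rightarrow> bool" where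
  "absolutely_continuous_nc \<mu> \<longleftrightarrow> closable_form (nc_form \<mu>)"


section \<open>Unbounded operators\<close>

text \<open>An unbounded operator is represented by its graph.\<close>

type_synonym 'a uop = "('a ell2 \<times> 'a ell2) set"

definition linear_uop :: "'a uop \<Rightarrow> bool" where
  "linear_uop T \<longleftrightarrow> single_valued T \<and> (0, 0) \<in> T \<and>
     (\<forall>(x, y)\<in>T. \<forall>(x', y')\<in>T. (x + x', y + y') \<in> T) \<and>
     (\<forall>c. \<forall>(x, y)\<in>T. (scaleC c x, scaleC c y) \<in> T)"

definition uop_apply :: "'a uop \<Rightarrow> 'a ell2 \<Rightarrow> 'a ell2" where
  "uop_apply T x = (THE y. (x, y) \<in> T)"

definition uop_adj :: "'a uop \<Rightarrow> 'a uop" where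
  "uop_adj T = {(y, z). \<forall>(x, w)\<in>T. cinner y w = cinner z x}"

definition selfadjoint_uop :: "'a uop \<Rightarrow> bool" where
  "selfadjoint_uop T \<longleftrightarrow> linear_uop T \<and> closure (Domain T) = UNIV \<and> uop_adj T = T"

definition positive_selfadjoint :: "'a uop \<Rightarrow> bool" where
  "positive_selfadjoint T \<longleftrightarrow> selfadjoint_uop T \<and> (\<forall>(x, y)\<in>T. cinner x y \<in> \<real>\<^sub>\<ge>\<^sub>0)"

text \<open>Relational composition of graphs gives the operator product on its natural domain.\<close>

definition uop_sqrt :: "'a uop \<Rightarrow> 'a uop" where
  "uop_sqrt T = (THE S. positive_selfadjoint S \<and> S O S = T)"

definition form_of_uop :: "'a uop \<Rightarrow> 'a sform" where
  "form_of_uop T = Form (Domain (uop_sqrt T))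
     (\<lambda>g h. cinner (uop_apply (uop_sqrt T) g) (uop_apply (uop_sqrt T) h))"

definition L_Toeplitz_uop :: "'d list uop \<Rightarrow> bool" where
  "L_Toeplitz_uop T \<longleftrightarrow> positive_selfadjoint T \<and> L_invariant (Domain (uop_sqrt T)) \<and>
     L_Toeplitz_form (form_of_uop T)"

definition is_core :: "'a ell2 set \<Rightarrow> 'a uop \<Rightarrow> bool" where
  "is_core D A \<longleftrightarrow> D \<subseteq> Domain A \<and> A \<subseteq> closure {(x, y) \<in> A. x \<in> D}"

end

theory Submission
  imports Defs
begin

text \<open>
  The relations \<open>L\<^sub>j\<^sup>* L\<^sub>k = \<delta>\<^sub>j\<^sub>k\<close> make \<open>q\<^sub>\<mu>\<close> a Toeplitz form, and the rest is the theory of closed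
  forms: the closure of \<open>q\<^sub>\<mu>\<close> is the form of a unique positive self-adjoint \<open>T\<close>, its form
  domain is the domain of \<open>\<surd>T\<close>, and the form norm is the graph norm of \<open>\<surd>T\<close>. So density of \<open>\<A>\<^sub>d\<close> in the
  form norm says that \<open>\<A>\<^sub>d\<close> is a core, and the Toeplitz relation passes to the closure because the shifts
  are isometric in the form norm.

  The operator theory avoids the spectral theorem by encoding an unbounded operator through its bounded
  resolvent \<open>B = (1 + T)\<inverse>\<close>, for which \<open>0 \<le> B \<le> 1\<close>. Bounded square roots come from a norm-convergent
  iteration (\<open>effect_sqrt_exists\<close>). Writing operators as graphs \<open>{(P y, Q y)}\<close> of pairs of commuting bounded
  operators, \<open>T\<close> corresponds to the pair \<open>(B, 1 - B)\<close> and \<open>\<surd>T\<close> to \<open>(\<surd>B, \<surd>(1 - B))\<close>. One criterion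
  (\<open>pair_graph_selfadjoint\<close>) makes both of them self-adjoint, and \<open>\<surd>T \<surd>T = T\<close> becomes algebra. The square root
  is unique (\<open>resolvent.S_unique\<close>), since any positive root of \<open>T\<close> commutes with \<open>B\<close> and therefore with \<open>\<surd>B\<close>.

  Every existence statement about \<open>B\<close> is an instance of one Riesz theorem (\<open>hilbert_form.riesz\<close>), for
  a subspace of the Hilbert space that is complete in a form of its own: with the form
  \<open>\<langle>x + T x, z + T z\<rangle>\<close> on the domain of a given \<open>T\<close> it yields the resolvent
  (\<open>positive_selfadjoint_resolvent\<close>), and with \<open>q + \<langle>\<cdot>, \<cdot>\<rangle>\<close> on the domain of a closed form \<open>q\<close> it yields the
  operator representing \<open>q\<close> (\<open>closed_form_representation\<close>).

  On the side of the disk algebra, \<open>q\<^sub>\<mu>\<close> refers to an operator \<open>a\<close> through the vector \<open>a 1\<close>; the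
  identification is legitimate because \<open>a\<close> commutes with the right shifts (\<open>disk_algebra_inj\<close>).
\<close>

section \<open>The Hilbert space\<close>

subsection \<open>Algebra of the inner product\<close>

lemma cinner_commute: "cinner x y = cnj (cinner y x)"
  by transfer (simp flip: infsum_cnj add: mult.commute)

lemma cinner_add_right: "cinner x (y + z) = cinner x y + cinner x z"
  by transfer (simp add: distrib_left infsum_add sq_summable_mult)

lemma cinner_scaleC_right: "cinner x (scaleC c y) = c * cinner x y"
  by transfer (simp add: mult.left_commute infsum_cmult_right')

lemma cinner_add_left: "cinner (x + y) z = cinner x z + cinner y z"
  using cinner_add_right[of z x y] cinner_commute by (metis complex_cnj_add)

lemma cinner_scaleC_left: "cinner (scaleC c x) y = cnj c * cinner x y"
  using cinner_scaleC_right[of y c x] cinner_commute by (metis complex_cnj_mult)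

lemma scaleC_of_real: "scaleC (of_real r) x = r *\<^sub>R x"
  by transfer simp

lemma scaleC_scaleC [simp]: "scaleC c (scaleC d x) = scaleC (c * d) x"
  by transfer (simp add: mult.assoc)

lemma scaleC_minus_one: "scaleC (-1) x = - x"
  by transfer simp

lemma scaleC_diff_right: "scaleC c (x - y) = scaleC c x - scaleC c y"
  by transfer (simp add: right_diff_distrib)

lemma cinner_scaleR_right: "cinner x (r *\<^sub>R y) = of_real r * cinner x y"
  using cinner_scaleC_right[of x "of_real r" y] by (simp add: scaleC_of_real)

lemma cinner_scaleR_left: "cinner (r *\<^sub>R x) y = of_real r * cinner x y"
  using cinner_scaleC_left[of "of_real r" x y] by (simp add: scaleC_of_real)

lemma cinner_self_norm: "cinner x x = of_real ((norm x)\<^sup>2)"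
  by (simp add: cinner_self norm_ell2_def infsum_nonneg)

lemma csubspace_diff: "csubspace D \<Longrightarrow> x \<in> D \<Longrightarrow> y \<in> D \<Longrightarrow> x - y \<in> D"
  unfolding csubspace_def by (metis scaleC_minus_one diff_conv_add_uminus)

text \<open>The real Cauchy-Schwarz inequality controls only the real part; rotating one argument by the
  phase of the inner product makes that real part the modulus.\<close>

lemma cmod_cinner_le: "cmod (cinner x y) \<le> norm x * norm y"
proof -
  define u where "u = cnj (sgn (cinner x y))"
  have "u * cinner x y = of_real (cmod (cinner x y))"
    using complex_norm_square[of "cinner x y"]
    by (cases "cinner x y = 0") (auto simp: u_def sgn_eq field_simps power2_eq_square)
  then have "cmod (cinner x y) = inner x (scaleC u y)"
    by (simp add: inner_ell2_def cinner_scaleC_right)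
  also have "\<dots> \<le> norm x * norm (scaleC u y)"
    by (rule norm_cauchy_schwarz)
  also have "\<dots> \<le> norm x * norm y"
    by (auto simp: norm_scaleC u_def norm_sgn)
  finally show ?thesis .
qed

interpretation cinner: bounded_bilinear cinner
  by unfold_locales
    (auto simp: cinner_add_left cinner_add_right cinner_scaleR_left cinner_scaleR_right
      scaleR_conv_of_real intro!: exI[of _ 1] cmod_cinner_le)

lemma cinner_basis: "cinner (ell2_basis i) x = Rep_ell2 x i"
proof -
  have "(\<Sum>\<^sub>\<infinity>j. cnj (of_bool (j = i)) * Rep_ell2 x j) = (\<Sum>\<^sub>\<infinity>j\<in>{i}. cnj (of_bool (j = i)) * Rep_ell2 x j)"
    by (rule infsum_cong_neutral) auto
  then show ?thesis by (simp add: cinner.rep_eq ell2_basis.rep_eq)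
qed

lemma cinner_ext_left: "(\<And>z. cinner x z = cinner y z) \<Longrightarrow> x = y"
  by (metis (no_types, lifting) cinner.diff_left cinner_self_norm diff_self of_real_eq_0_iff
      power_eq_0_iff norm_eq_zero right_minus_eq)

lemma cinner_ext_right: "(\<And>z. cinner z x = cinner z y) \<Longrightarrow> x = y"
  by (rule cinner_ext_left) (metis cinner_commute)

text \<open>Coordinates of a Cauchy sequence converge, and every finite partial sum of squares is
  controlled uniformly by the Cauchy bound, so the coordinatewise limit is square-summable and is
  the limit in norm.\<close>

instance ell2 :: (type) complete_space
proof
  fix X :: "nat \<Rightarrow> 'a ell2"
  assume "Cauchy X"
  have coord: "Cauchy (\<lambda>n. Rep_ell2 (X n) i)" for i
    using bounded_linear.Cauchy[OF cinner.bounded_linear_right \<open>Cauchy X\<close>, of "ell2_basis i"]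
    by (simp add: cinner_basis)
  define f where "f i = lim (\<lambda>n. Rep_ell2 (X n) i)" for i
  have f: "(\<lambda>n. Rep_ell2 (X n) i) \<longlonglongrightarrow> f i" for i
    unfolding f_def using coord[of i] Cauchy_convergent_iff convergent_LIMSEQ_iff by blast
  have bound: "(\<Sum>i\<in>F. (cmod (Rep_ell2 (X n) i - f i))\<^sup>2) \<le> e\<^sup>2"
    if N: "\<And>m. m \<ge> n \<Longrightarrow> norm (X n - X m) \<le> e" and F: "finite F" for F n e
  proof (rule tendsto_upperbound)
    show "(\<lambda>m. \<Sum>i\<in>F. (cmod (Rep_ell2 (X n) i - Rep_ell2 (X m) i))\<^sup>2) \<longlonglongrightarrow>
        (\<Sum>i\<in>F. (cmod (Rep_ell2 (X n) i - f i))\<^sup>2)"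
      by (intro tendsto_intros f)
    have "(\<Sum>i\<in>F. (cmod (Rep_ell2 (X n) i - Rep_ell2 (X m) i))\<^sup>2) \<le> e\<^sup>2" if "m \<ge> n" for m
    proof -
      have "(\<Sum>i\<in>F. (cmod (Rep_ell2 (X n) i - Rep_ell2 (X m) i))\<^sup>2) =
          (\<Sum>i\<in>F. (cmod (Rep_ell2 (X n - X m) i))\<^sup>2)"
        by (simp add: minus_ell2.rep_eq)
      also have "\<dots> \<le> (\<Sum>\<^sub>\<infinity>i. (cmod (Rep_ell2 (X n - X m) i))\<^sup>2)"
        using Rep_ell2[of "X n - X m"] by (intro finite_sum_le_infsum) (use F in auto)
      also have "\<dots> = (norm (X n - X m))\<^sup>2"
        by (simp add: norm_ell2_def infsum_nonneg)
      also have "\<dots> \<le> e\<^sup>2"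
        using N[OF that] by (intro power_mono) auto
      finally show ?thesis .
    qed
    then show "\<forall>\<^sub>F m in sequentially. (\<Sum>i\<in>F. (cmod (Rep_ell2 (X n) i - Rep_ell2 (X m) i))\<^sup>2) \<le> e\<^sup>2"
      unfolding eventually_sequentially by blast
  qed auto
  have summable: "(\<lambda>i. (cmod (Rep_ell2 (X n) i - f i))\<^sup>2) summable_on UNIV"
    and small: "(\<Sum>\<^sub>\<infinity>i. (cmod (Rep_ell2 (X n) i - f i))\<^sup>2) \<le> e\<^sup>2"
    if "\<And>m. m \<ge> n \<Longrightarrow> norm (X n - X m) \<le> e" for n e
  proof -
    show "(\<lambda>i. (cmod (Rep_ell2 (X n) i - f i))\<^sup>2) summable_on UNIV"
      by (rule nonneg_bdd_above_summable_on) (auto intro!: bdd_aboveI2 bound[OF that])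
    then show "(\<Sum>\<^sub>\<infinity>i. (cmod (Rep_ell2 (X n) i - f i))\<^sup>2) \<le> e\<^sup>2"
      by (rule infsum_le_finite_sums) (use bound[OF that] in auto)
  qed
  have Cau: "\<exists>N. \<forall>n\<ge>N. \<forall>m\<ge>n. norm (X n - X m) \<le> e" if "e > 0" for e
    using CauchyD[OF \<open>Cauchy X\<close> that] by (meson less_imp_le order_trans)
  obtain N where N: "\<And>m. m \<ge> N \<Longrightarrow> norm (X N - X m) \<le> 1"
    using Cau[of 1] by auto
  define y where "y = X N - Abs_ell2 (\<lambda>i. Rep_ell2 (X N) i - f i)"
  have y: "Rep_ell2 y i = f i" for i
    using summable[of N 1, OF N] by (simp add: y_def minus_ell2.rep_eq Abs_ell2_inverse)
  have "X \<longlonglongrightarrow> y"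
  proof (rule metric_LIMSEQ_I)
    fix r :: real assume "r > 0"
    then obtain M where M: "\<forall>n\<ge>M. \<forall>m\<ge>n. norm (X n - X m) \<le> r / 2"
      using Cau[of "r / 2"] by auto
    have "dist (X n) y < r" if "n \<ge> M" for n
    proof -
      have "(\<Sum>\<^sub>\<infinity>i. (cmod (Rep_ell2 (X n) i - f i))\<^sup>2) \<le> (r / 2)\<^sup>2"
        using M that by (intro small) auto
      then have "norm (X n - y) \<le> sqrt ((r / 2)\<^sup>2)"
        unfolding norm_ell2_def minus_ell2.rep_eq y by (rule real_sqrt_le_mono)
      then show ?thesis using \<open>r > 0\<close> by (simp add: dist_norm)
    qed
    then show "\<exists>no. \<forall>n\<ge>no. dist (X n) y < r" by blast
  qed
  then show "convergent X" by (rule convergentI)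
qed

instance ell2 :: (type) banach ..

section \<open>Hilbert spaces carried by a form\<close>

text \<open>Form domains, domains of self-adjoint operators and the Hilbert space itself are all complete in
  an inner product \<open>p\<close> that dominates the ambient one. Keeping them as subspaces with their own \<open>p\<close>
  gives one Riesz theorem for all of them; coercivity turns limits in the norm of \<open>p\<close> into limits
  in the ambient norm.\<close>

locale hilbert_form =
  fixes D :: "'a ell2 set" and p :: "'a ell2 \<Rightarrow> 'a ell2 \<Rightarrow> complex"
  assumes subspace: "csubspace D"
    and add_right: "x \<in> D \<Longrightarrow> y \<in> D \<Longrightarrow> z \<in> D \<Longrightarrow> p x (y + z) = p x y + p x z"
    and scale_right: "x \<in> D \<Longrightarrow> y \<in> D \<Longrightarrow> p x (scaleC c y) = c * p x y"
    and hermitian: "x \<in> D \<Longrightarrow> y \<in> D \<Longrightarrow> p y x = cnj (p x y)"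
    and coercive: "x \<in> D \<Longrightarrow> (norm x)\<^sup>2 \<le> Re (p x x)"
    and complete: "(\<And>n. X n \<in> D) \<Longrightarrow>
        (\<And>e. e > 0 \<Longrightarrow> \<exists>N. \<forall>m\<ge>N. \<forall>n\<ge>N. sqrt (Re (p (X m - X n) (X m - X n))) < e) \<Longrightarrow>
        \<exists>x\<in>D. (\<lambda>n. sqrt (Re (p (X n - x) (X n - x)))) \<longlonglongrightarrow> 0"
begin

definition pn :: "'a ell2 \<Rightarrow> real" where
  "pn x = sqrt (Re (p x x))"

lemma zero_mem: "0 \<in> D"
  and add_mem: "x \<in> D \<Longrightarrow> y \<in> D \<Longrightarrow> x + y \<in> D"
  and scale_mem: "x \<in> D \<Longrightarrow> scaleC c x \<in> D"
  and diff_mem: "x \<in> D \<Longrightarrow> y \<in> D \<Longrightarrow> x - y \<in> D"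
  using subspace csubspace_diff by (auto simp: csubspace_def)

lemma scaleR_mem: "x \<in> D \<Longrightarrow> r *\<^sub>R x \<in> D"
  using scale_mem[of x "of_real r"] by (simp add: scaleC_of_real)

lemma add_left: "x \<in> D \<Longrightarrow> y \<in> D \<Longrightarrow> z \<in> D \<Longrightarrow> p (x + y) z = p x z + p y z"
  using add_right[of z x y] hermitian by (metis complex_cnj_add add_mem)

lemma scale_left: "x \<in> D \<Longrightarrow> y \<in> D \<Longrightarrow> p (scaleC c x) y = cnj c * p x y"
  using scale_right[of y x c] hermitian by (metis complex_cnj_mult scale_mem)

lemma scaleR_right: "x \<in> D \<Longrightarrow> y \<in> D \<Longrightarrow> p x (r *\<^sub>R y) = of_real r * p x y"
  using scale_right[of x y "of_real r"] by (simp add: scaleC_of_real)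

lemma scaleR_left: "x \<in> D \<Longrightarrow> y \<in> D \<Longrightarrow> p (r *\<^sub>R x) y = of_real r * p x y"
  using scale_left[of x y "of_real r"] by (simp add: scaleC_of_real)

lemma diff_right: "x \<in> D \<Longrightarrow> y \<in> D \<Longrightarrow> z \<in> D \<Longrightarrow> p x (y - z) = p x y - p x z"
  using add_right[of x "y - z" z] diff_mem by simp

lemma diff_left: "x \<in> D \<Longrightarrow> y \<in> D \<Longrightarrow> z \<in> D \<Longrightarrow> p (x - y) z = p x z - p y z"
  using add_left[of "x - y" y z] diff_mem by simp

lemma Re_nonneg: "x \<in> D \<Longrightarrow> 0 \<le> Re (p x x)"
  using coercive[of x] zero_le_power2[of "norm x"] by linarith

lemma Re_commute: "x \<in> D \<Longrightarrow> y \<in> D \<Longrightarrow> Re (p y x) = Re (p x y)"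
  using hermitian[of x y] by simp

lemma pn_square: "x \<in> D \<Longrightarrow> (pn x)\<^sup>2 = Re (p x x)"
  by (simp add: pn_def Re_nonneg)

lemma pn_nonneg: "x \<in> D \<Longrightarrow> 0 \<le> pn x"
  by (simp add: pn_def Re_nonneg)

lemma norm_le_pn: "x \<in> D \<Longrightarrow> norm x \<le> pn x"
  using coercive[of x] unfolding pn_def by (intro real_le_rsqrt)

lemma Re_cauchy_schwarz:
  assumes x: "x \<in> D" and y: "y \<in> D"
  shows "Re (p x y) \<le> pn x * pn y"
proof (cases "y = 0")
  case True
  then show ?thesis
    using scaleR_right[OF x y, of 0] pn_nonneg x y by simp
next
  case False
  define t where "t = Re (p x y) / Re (p y y)"
  have pos: "Re (p y y) > 0"
    using coercive[OF y] zero_less_power2[of "norm y"] False by (smt (verit) norm_eq_zero)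
  have "0 \<le> Re (p (x - t *\<^sub>R y) (x - t *\<^sub>R y))"
    by (intro Re_nonneg diff_mem scaleR_mem x y)
  also have "\<dots> = Re (p x x) - 2 * t * Re (p x y) + t * t * Re (p y y)"
    using x y by (simp add: diff_left diff_right diff_mem scaleR_mem scaleR_left scaleR_right
        Re_commute[OF x y] algebra_simps)
  also have "\<dots> = Re (p x x) - (Re (p x y))\<^sup>2 / Re (p y y)"
    using pos by (simp add: t_def field_simps power2_eq_square)
  finally have "(Re (p x y))\<^sup>2 \<le> Re (p x x) * Re (p y y)"
    using pos by (simp add: field_simps)
  then have "(Re (p x y))\<^sup>2 \<le> (pn x * pn y)\<^sup>2"
    by (simp add: power_mult_distrib pn_square x y)
  then show ?thesis
    by (rule power2_le_imp_le) (simp add: pn_nonneg x y)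
qed

lemma pn_scale: "x \<in> D \<Longrightarrow> pn (scaleC c x) = cmod c * pn x"
proof -
  assume x: "x \<in> D"
  have "p (scaleC c x) (scaleC c x) = of_real ((cmod c)\<^sup>2) * p x x"
    using x scale_mem[OF x] by (simp add: scale_left scale_right complex_norm_square ac_simps del: of_real_power)
  then have "Re (p (scaleC c x) (scaleC c x)) = (cmod c)\<^sup>2 * Re (p x x)"
    by simp
  then show ?thesis by (simp add: pn_def real_sqrt_mult)
qed

lemma cauchy_schwarz:
  assumes x: "x \<in> D" and y: "y \<in> D"
  shows "cmod (p x y) \<le> pn x * pn y"
proof -
  define u where "u = cnj (sgn (p x y))"
  have "u * p x y = of_real (cmod (p x y))"
    using complex_norm_square[of "p x y"]
    by (cases "p x y = 0") (auto simp: u_def sgn_eq field_simps power2_eq_square)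
  then have "cmod (p x y) = Re (p x (scaleC u y))"
    by (simp add: scale_right x y)
  also have "\<dots> \<le> pn x * pn (scaleC u y)"
    by (rule Re_cauchy_schwarz) (simp_all add: x y scale_mem)
  also have "\<dots> \<le> pn x * pn y"
    using pn_nonneg[OF x] pn_nonneg[OF y] by (auto simp: pn_scale y u_def norm_sgn)
  finally show ?thesis .
qed

lemma pn_triangle:
  assumes x: "x \<in> D" and y: "y \<in> D"
  shows "pn (x + y) \<le> pn x + pn y"
proof (rule power2_le_imp_le)
  have "(pn (x + y))\<^sup>2 = Re (p x x) + 2 * Re (p x y) + Re (p y y)"
    using x y by (simp add: pn_square add_mem add_left add_right Re_commute[OF x y])
  also have "\<dots> \<le> (pn x + pn y)\<^sup>2"
    using Re_cauchy_schwarz[OF x y] by (simp add: power2_sum pn_square x y)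
  finally show "(pn (x + y))\<^sup>2 \<le> (pn x + pn y)\<^sup>2" .
qed (simp add: pn_nonneg x y)

lemma pn_minus_commute: "x \<in> D \<Longrightarrow> y \<in> D \<Longrightarrow> pn (x - y) = pn (y - x)"
  using pn_scale[of "x - y" "-1"] diff_mem by (simp add: scaleC_minus_one)

lemma pn_diff_le: "x \<in> D \<Longrightarrow> y \<in> D \<Longrightarrow> z \<in> D \<Longrightarrow> pn (x - z) \<le> pn (x - y) + pn (y - z)"
  using pn_triangle[of "x - y" "y - z"] diff_mem by simp

definition pcauchy :: "(nat \<Rightarrow> 'a ell2) \<Rightarrow> bool" where
  "pcauchy X \<longleftrightarrow> (\<forall>e>0. \<exists>N. \<forall>m\<ge>N. \<forall>n\<ge>N. pn (X m - X n) < e)"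

definition plim :: "(nat \<Rightarrow> 'a ell2) \<Rightarrow> 'a ell2 \<Rightarrow> bool" where
  "plim X x \<longleftrightarrow> (\<lambda>n. pn (X n - x)) \<longlonglongrightarrow> 0"

lemma pcauchy_plim: "(\<And>n. X n \<in> D) \<Longrightarrow> pcauchy X \<Longrightarrow> \<exists>x\<in>D. plim X x"
  using complete[of X] unfolding plim_def pn_def pcauchy_def by blast

lemma plim_norm:
  assumes X: "\<And>n. X n \<in> D" and x: "x \<in> D" and lim: "plim X x"
  shows "X \<longlonglongrightarrow> x"
proof (rule LIM_zero_cancel, rule Lim_null_comparison)
  show "\<forall>\<^sub>F n in sequentially. norm (X n - x) \<le> pn (X n - x)"
    by (simp add: norm_le_pn diff_mem X x)
  show "(\<lambda>n. pn (X n - x)) \<longlonglongrightarrow> 0"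
    using lim by (simp add: plim_def)
qed

lemma plim_pcauchy:
  assumes X: "\<And>n. X n \<in> D" and x: "x \<in> D" and lim: "plim X x"
  shows "pcauchy X"
  unfolding pcauchy_def
proof (intro allI impI)
  fix e :: real assume "e > 0"
  then obtain N where N: "\<And>n. n \<ge> N \<Longrightarrow> pn (X n - x) < e / 2"
    using order_tendstoD(2)[OF lim[unfolded plim_def], of "e / 2"]
    unfolding eventually_sequentially by auto
  have "pn (X m - X n) < e" if "m \<ge> N" "n \<ge> N" for m n
    using pn_diff_le[OF X x X, of m n] pn_minus_commute[OF x X, of n] N[OF that(1)] N[OF that(2)]
    by simp
  then show "\<exists>N. \<forall>m\<ge>N. \<forall>n\<ge>N. pn (X m - X n) < e" by blast
qed

lemma tendsto_p:
  assumes X: "\<And>n. X n \<in> D" and x: "x \<in> D" and limX: "plim X x"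
    and Y: "\<And>n. Y n \<in> D" and y: "y \<in> D" and limY: "plim Y y"
  shows "(\<lambda>n. p (X n) (Y n)) \<longlonglongrightarrow> p x y"
proof -
  have 1: "(\<lambda>n. pn (X n - x) * pn (Y n - y) + pn (X n - x) * pn y + pn x * pn (Y n - y))
      \<longlonglongrightarrow> 0 * 0 + 0 * pn y + pn x * 0"
    using limX limY unfolding plim_def by (intro tendsto_intros)
  have 2: "cmod (p (X n) (Y n) - p x y) \<le>
      pn (X n - x) * pn (Y n - y) + pn (X n - x) * pn y + pn x * pn (Y n - y)" for n
  proof -
    have "p (X n) (Y n) - p x y = p (X n - x) (Y n - y) + p (X n - x) y + p x (Y n - y)"
      using X Y x y by (simp add: diff_left diff_right diff_mem)
    then show ?thesis
      using cauchy_schwarz[of "X n - x" "Y n - y"] cauchy_schwarz[of "X n - x" y]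
        cauchy_schwarz[of x "Y n - y"] norm_triangle_ineq[of "p (X n - x) (Y n - y) + p (X n - x) y" "p x (Y n - y)"]
        norm_triangle_ineq[of "p (X n - x) (Y n - y)" "p (X n - x) y"] X Y x y diff_mem
      by fastforce
  qed
  have "(\<lambda>n. p (X n) (Y n) - p x y) \<longlonglongrightarrow> 0"
    by (rule Lim_null_comparison[OF _ 1[simplified]]) (simp add: 2)
  then show ?thesis by (rule LIM_zero_cancel)
qed

lemma plim_const: "x \<in> D \<Longrightarrow> plim (\<lambda>n. x) x"
  using scaleR_right[of 0 0 0] zero_mem by (simp add: plim_def pn_def)

lemma plim_add:
  assumes X: "\<And>n. X n \<in> D" and x: "x \<in> D" and limX: "plim X x"
    and Y: "\<And>n. Y n \<in> D" and y: "y \<in> D" and limY: "plim Y y"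
  shows "plim (\<lambda>n. X n + Y n) (x + y)"
proof -
  have 1: "(\<lambda>n. pn (X n - x) + pn (Y n - y)) \<longlonglongrightarrow> 0 + 0"
    using limX limY unfolding plim_def by (intro tendsto_intros)
  have "norm (pn (X n + Y n - (x + y))) \<le> pn (X n - x) + pn (Y n - y)" for n
    using pn_triangle[of "X n - x" "Y n - y"] pn_nonneg[of "X n - x + (Y n - y)"]
      X Y x y diff_mem add_mem by (simp add: algebra_simps)
  then show ?thesis
    unfolding plim_def by (intro Lim_null_comparison[OF _ 1[simplified]]) simp
qed

lemma plim_scale:
  assumes X: "\<And>n. X n \<in> D" and x: "x \<in> D" and limX: "plim X x"
  shows "plim (\<lambda>n. scaleC c (X n)) (scaleC c x)"
proof -
  have "(\<lambda>n. cmod c * pn (X n - x)) \<longlonglongrightarrow> cmod c * 0"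
    using limX unfolding plim_def by (intro tendsto_intros)
  then show ?thesis
    using X x by (simp add: plim_def pn_scale diff_mem flip: scaleC_diff_right)
qed

subsection \<open>The Riesz representation theorem\<close>

text \<open>A minimising sequence of \<open>z \<mapsto> \<parallel>z\<parallel>\<^sup>2 - 2 Re (f z)\<close> is Cauchy by the parallelogram law. The
  first variation at its limit gives the real part of the identity; the imaginary part follows by
  testing with \<open>\<i> z\<close>.\<close>

theorem riesz:
  assumes f_add: "\<And>y z. y \<in> D \<Longrightarrow> z \<in> D \<Longrightarrow> f (y + z) = f y + f z"
    and f_scale: "\<And>c z. z \<in> D \<Longrightarrow> f (scaleC c z) = c * f z"
    and f_bound: "\<And>z. z \<in> D \<Longrightarrow> cmod (f z) \<le> K * pn z"
  shows "\<exists>x\<in>D. \<forall>z\<in>D. p x z = f z"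
proof -
  define J where "J z = Re (p z z) - 2 * Re (f z)" for z
  have f_scaleR: "f (r *\<^sub>R z) = of_real r * f z" if "z \<in> D" for r z
    using f_scale[OF that, of "of_real r"] by (simp add: scaleC_of_real)
  have J_lower: "- K\<^sup>2 \<le> J z" if "z \<in> D" for z
  proof -
    have "Re (f z) \<le> K * pn z"
      using f_bound[OF that] complex_Re_le_cmod[of "f z"] by linarith
    moreover have "0 \<le> (pn z - K)\<^sup>2" by simp
    ultimately show ?thesis
      unfolding J_def pn_square[OF that, symmetric] by (simp add: power2_eq_square algebra_simps)
  qed
  define m where "m = Inf (J ` D)"
  have bdd: "bdd_below (J ` D)"
    using J_lower by (intro bdd_belowI2)
  have m_le: "m \<le> J z" if "z \<in> D" for z
    unfolding m_def by (rule cINF_lower[OF bdd that])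
  have "\<exists>z\<in>D. J z < m + 1 / real (Suc n)" for n
    using cInf_lessD[of "J ` D" "m + 1 / real (Suc n)"] zero_mem unfolding m_def by fastforce
  then obtain X where X: "\<And>n. X n \<in> D" and JX: "\<And>n. J (X n) < m + 1 / real (Suc n)"
    by metis
  \<comment> \<open>the parallelogram law, with the linear terms of \<open>J\<close> cancelling\<close>
  have gap: "(pn (a - b))\<^sup>2 = 2 * J a + 2 * J b - 4 * J ((1/2) *\<^sub>R (a + b))"
    if a: "a \<in> D" and b: "b \<in> D" for a b
  proof -
    have "Re (p (a - b) (a - b)) = Re (p a a) + Re (p b b) - 2 * Re (p a b)"
      using a b by (simp add: diff_left diff_right diff_mem Re_commute[OF a b])
    moreover have half: "J ((1/2) *\<^sub>R (a + b)) =
        (Re (p a a) + Re (p b b) + 2 * Re (p a b)) / 4 - (Re (f a) + Re (f b))"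
      using a b by (simp add: J_def scaleR_left scaleR_right scaleR_mem add_left add_right add_mem
          Re_commute[OF a b] f_scaleR f_add field_simps)
    ultimately show ?thesis
      unfolding pn_square[OF diff_mem[OF a b]] half J_def[of a] J_def[of b] by (simp add: field_simps)
  qed
  have "pcauchy X"
    unfolding pcauchy_def
  proof (intro allI impI)
    fix e :: real assume e: "e > 0"
    obtain N where "1 / real (Suc N) < e\<^sup>2 / 4"
      using e by (auto intro: nat_approx_posE[of "e\<^sup>2 / 4"])
    then have N: "4 / real (Suc N) < e\<^sup>2" by simp
    have "pn (X i - X j) < e" if "i \<ge> N" "j \<ge> N" for i j
    proof (rule power2_less_imp_less)
      have "(pn (X i - X j))\<^sup>2 < 2 * (m + 1 / real (Suc i)) + 2 * (m + 1 / real (Suc j)) - 4 * m"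
        using gap[OF X X, of i j] JX[of i] JX[of j]
          m_le[of "(1/2) *\<^sub>R (X i + X j)"] X add_mem scaleR_mem by fastforce
      also have "\<dots> = 2 / real (Suc i) + 2 / real (Suc j)"
        by simp
      also have "\<dots> \<le> 2 / real (Suc N) + 2 / real (Suc N)"
        using that by (intro add_mono divide_left_mono) auto
      also have "\<dots> < e\<^sup>2" using N by simp
      finally show "(pn (X i - X j))\<^sup>2 < e\<^sup>2" .
    qed (use e in auto)
    then show "\<exists>N. \<forall>m\<ge>N. \<forall>n\<ge>N. pn (X m - X n) < e" by blast
  qed
  then obtain x where x: "x \<in> D" and lim: "plim X x"
    using pcauchy_plim[of X] X by blast
  have variation: "0 \<le> t\<^sup>2 * Re (p z z) + 2 * t * (Re (p x z) - Re (f z))" if z: "z \<in> D" for z t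
  proof (rule tendsto_lowerbound)
    show "(\<lambda>n. t\<^sup>2 * Re (p z z) + 2 * t * (Re (p (X n) z) - Re (f z)) + 1 / real (Suc n))
        \<longlonglongrightarrow> t\<^sup>2 * Re (p z z) + 2 * t * (Re (p x z) - Re (f z))"
    proof -
      have "(\<lambda>n. 1 / real (Suc n)) \<longlonglongrightarrow> 0"
        using LIMSEQ_inverse_real_of_nat by (simp add: inverse_eq_divide)
      then have "(\<lambda>n. t\<^sup>2 * Re (p z z) + 2 * t * (Re (p (X n) z) - Re (f z)) + 1 / real (Suc n))
        \<longlonglongrightarrow> t\<^sup>2 * Re (p z z) + 2 * t * (Re (p x z) - Re (f z)) + 0"
        by (intro tendsto_intros tendsto_p[OF X x lim] plim_const z)
      then show ?thesis by simp
    qed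
    have "0 \<le> t\<^sup>2 * Re (p z z) + 2 * t * (Re (p (X n) z) - Re (f z)) + 1 / real (Suc n)" for n
    proof -
      have "J (X n + t *\<^sub>R z) = J (X n) + t\<^sup>2 * Re (p z z) + 2 * t * (Re (p (X n) z) - Re (f z))"
        using X[of n] z by (simp add: J_def add_left add_right add_mem scaleR_mem scaleR_left
            scaleR_right Re_commute[OF X z] f_add f_scaleR power2_eq_square algebra_simps)
      then show ?thesis
        using m_le[of "X n + t *\<^sub>R z"] JX[of n] X z add_mem scaleR_mem by fastforce
    qed
    then show "\<forall>\<^sub>F n in sequentially.
        0 \<le> t\<^sup>2 * Re (p z z) + 2 * t * (Re (p (X n) z) - Re (f z)) + 1 / real (Suc n)"
      by simp
  qed auto
  have Re_eq: "Re (p x z) = Re (f z)" if z: "z \<in> D" for z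
  proof (rule ccontr)
    assume ne: "Re (p x z) \<noteq> Re (f z)"
    \<comment> \<open>\<open>a\<close> exceeds \<open>Re (p z z)\<close> and is positive, so that \<open>t = - c / a\<close> makes the variation negative even when
      \<open>p z z = 0\<close>.\<close>
    define c where "c = Re (p x z) - Re (f z)"
    define a where "a = Re (p z z) + 1"
    have a: "a > 0" using Re_nonneg[OF z] by (simp add: a_def)
    have "0 \<le> (c / a)\<^sup>2 * Re (p z z) - 2 * (c / a) * c"
      using variation[OF z, of "- c / a", folded c_def] by (simp add: power2_eq_square)
    also have "\<dots> < (c / a)\<^sup>2 * a - 2 * (c / a) * c"
      using ne a unfolding c_def
      by (intro diff_strict_right_mono mult_strict_left_mono) (auto simp: a_def)
    also have "\<dots> = - c\<^sup>2 / a"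
      using a by (simp add: field_simps power2_eq_square)
    also have "\<dots> \<le> 0" using a by simp
    finally show False by simp
  qed
  have "p x z = f z" if z: "z \<in> D" for z
  proof (rule complex_eqI)
    show "Im (p x z) = Im (f z)"
      using Re_eq[OF scale_mem[OF z, of \<i>]] by (simp add: scale_right x z f_scale)
  qed (rule Re_eq[OF z])
  then show ?thesis using x by blast
qed

subsection \<open>Closures in the form norm\<close>

definition pclosure :: "'a ell2 set \<Rightarrow> 'a ell2 set" where
  "pclosure E = {x \<in> D. \<exists>X. (\<forall>n. X n \<in> E) \<and> plim X x}"

lemma pclosure_subset: "E \<subseteq> D \<Longrightarrow> E \<subseteq> pclosure E"
proof
  fix x assume "E \<subseteq> D" and x: "x \<in> E"
  then have "x \<in> D" and "plim (\<lambda>n. x) x" using plim_const by auto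
  then show "x \<in> pclosure E" using x by (auto simp: pclosure_def)
qed

lemma pclosure_approx:
  assumes E: "E \<subseteq> D" and x: "x \<in> pclosure E" and e: "e > 0"
  shows "\<exists>y\<in>E. pn (y - x) < e"
proof -
  obtain X where X: "\<And>n. X n \<in> E" and lim: "plim X x"
    using x by (auto simp: pclosure_def)
  obtain n where "pn (X n - x) < e"
    using eventually_happens'[OF _ order_tendstoD(2)[OF lim[unfolded plim_def] e]] by auto
  then show ?thesis using X by blast
qed

text \<open>Completeness is a diagonal argument: the members of a Cauchy sequence are limits of elements of \<open>E\<close>,
  and replacing the \<open>n\<close>-th one by an element of \<open>E\<close> within \<open>1 / (n + 1)\<close> keeps the limit.\<close>

lemma hilbert_form_pclosure:
  assumes E: "csubspace E" "E \<subseteq> D"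
  shows "hilbert_form (pclosure E) p"
proof
  have sub: "x \<in> pclosure E \<Longrightarrow> x \<in> D" for x by (simp add: pclosure_def)
  show "csubspace (pclosure E)"
    unfolding csubspace_def
  proof (intro conjI ballI allI)
    show "0 \<in> pclosure E"
      using E pclosure_subset by (auto simp: csubspace_def)
  next
    fix x y assume "x \<in> pclosure E" "y \<in> pclosure E"
    then obtain X Y where *: "x \<in> D" "y \<in> D" "\<And>n. X n \<in> E" "plim X x" "\<And>n. Y n \<in> E" "plim Y y"
      by (auto simp: pclosure_def)
    then have "plim (\<lambda>n. X n + Y n) (x + y)"
      using E(2) by (intro plim_add) auto
    moreover have "X n + Y n \<in> E" for n using * E(1) by (auto simp: csubspace_def)
    ultimately show "x + y \<in> pclosure E"
      unfolding pclosure_def using add_mem[OF *(1,2)] by (auto intro!: exI[of _ "\<lambda>n. X n + Y n"])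
  next
    fix c x assume "x \<in> pclosure E"
    then obtain X where *: "x \<in> D" "\<And>n. X n \<in> E" "plim X x"
      by (auto simp: pclosure_def)
    then have "plim (\<lambda>n. scaleC c (X n)) (scaleC c x)"
      using E(2) by (intro plim_scale) auto
    moreover have "scaleC c (X n) \<in> E" for n using * E(1) by (auto simp: csubspace_def)
    ultimately show "scaleC c x \<in> pclosure E"
      unfolding pclosure_def using scale_mem[OF *(1)] by (auto intro!: exI[of _ "\<lambda>n. scaleC c (X n)"])
  qed
  fix X :: "nat \<Rightarrow> 'a ell2"
  assume X: "\<And>n. X n \<in> pclosure E"
    and "\<And>e. e > 0 \<Longrightarrow> \<exists>N. \<forall>m\<ge>N. \<forall>n\<ge>N. sqrt (Re (p (X m - X n) (X m - X n))) < e"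
  then have "pcauchy X" by (simp add: pcauchy_def pn_def)
  then obtain x where x: "x \<in> D" and lim: "plim X x"
    using pcauchy_plim[of X] X sub by blast
  have "\<exists>y\<in>E. pn (y - X n) < 1 / real (Suc n)" for n
    by (rule pclosure_approx[OF E(2) X]) simp
  then obtain Y where Y: "\<And>n. Y n \<in> E" and YX: "\<And>n. pn (Y n - X n) < 1 / real (Suc n)"
    by metis
  have YD: "Y n \<in> D" and XD: "X n \<in> D" for n using Y X E(2) sub by auto
  have limY: "plim Y x"
    unfolding plim_def
  proof (rule Lim_null_comparison)
    have "norm (pn (Y n - x)) \<le> 1 / real (Suc n) + pn (X n - x)" for n
      using pn_diff_le[OF YD XD x, of n n] YX[of n] pn_nonneg[OF diff_mem[OF YD x], of n] by simp
    then show "\<forall>\<^sub>F n in sequentially. norm (pn (Y n - x)) \<le> 1 / real (Suc n) + pn (X n - x)"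
      by simp
    have "(\<lambda>n. 1 / real (Suc n)) \<longlonglongrightarrow> 0"
      using LIMSEQ_inverse_real_of_nat by (simp add: inverse_eq_divide)
    then show "(\<lambda>n. 1 / real (Suc n) + pn (X n - x)) \<longlonglongrightarrow> 0"
      using tendsto_add[of _ 0 _ _ 0] lim by (fastforce simp: plim_def)
  qed
  have "x \<in> pclosure E"
    using x Y limY by (auto simp: pclosure_def)
  then show "\<exists>x\<in>pclosure E. (\<lambda>n. sqrt (Re (p (X n - x) (X n - x)))) \<longlonglongrightarrow> 0"
    using lim[unfolded plim_def pn_def] by (rule rev_bexI)
qed (auto simp: pclosure_def intro: add_right scale_right hermitian coercive)

text \<open>The Riesz theorem inside the closure of \<open>E\<close>, applied to the functional \<open>p x\<close>, produces the orthogonal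
  projection \<open>m\<close> of \<open>x\<close>; then \<open>x - m\<close> is orthogonal to \<open>E\<close>.\<close>

lemma dense_if_no_orthogonal:
  assumes E: "csubspace E" "E \<subseteq> D"
    and orth: "\<And>x. x \<in> D \<Longrightarrow> (\<And>z. z \<in> E \<Longrightarrow> p x z = 0) \<Longrightarrow> x = 0"
  shows "pclosure E = D"
proof
  show "pclosure E \<subseteq> D" by (auto simp: pclosure_def)
  show "D \<subseteq> pclosure E"
  proof
    fix x assume x: "x \<in> D"
    interpret M: hilbert_form "pclosure E" p by (rule hilbert_form_pclosure[OF E])
    have sub: "z \<in> pclosure E \<Longrightarrow> z \<in> D" for z by (simp add: pclosure_def)
    have "\<exists>m\<in>pclosure E. \<forall>z\<in>pclosure E. p m z = p x z"
    proof (rule M.riesz)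
      fix z assume "z \<in> pclosure E"
      then show "cmod (p x z) \<le> pn x * M.pn z"
        using cauchy_schwarz[OF x] sub by (simp add: pn_def M.pn_def)
    qed (auto simp: add_right scale_right x sub)
    then obtain m where m: "m \<in> pclosure E" and *: "\<And>z. z \<in> pclosure E \<Longrightarrow> p m z = p x z"
      by blast
    have "x - m = 0"
    proof (rule orth)
      show "x - m \<in> D" using x m sub diff_mem by blast
      fix z assume "z \<in> E"
      then show "p (x - m) z = 0"
        using *[of z] pclosure_subset[OF E(2)] x m sub E(2) by (auto simp: diff_left)
    qed
    then show "x \<in> pclosure E" using m by simp
  qed
qed

end

section \<open>Bounded operators\<close>

lemma hilbert_form_cinner: "hilbert_form UNIV cinner"
proof
  fix X :: "nat \<Rightarrow> 'a ell2"
  assume "\<And>e. e > 0 \<Longrightarrow> \<exists>N. \<forall>m\<ge>N. \<forall>n\<ge>N. sqrt (Re (cinner (X m - X n) (X m - X n))) < e"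
  then have "Cauchy X"
    by (simp add: Cauchy_iff cinner_self_norm)
  then obtain x where "X \<longlonglongrightarrow> x"
    using Cauchy_convergent[of X] by (auto simp: convergent_def)
  then have "(\<lambda>n. norm (X n - x)) \<longlonglongrightarrow> 0"
    by (simp add: LIM_zero tendsto_norm_zero)
  then show "\<exists>x\<in>UNIV. (\<lambda>n. sqrt (Re (cinner (X n - x) (X n - x)))) \<longlonglongrightarrow> 0"
    by (auto simp: cinner_self_norm)
next
  fix x y :: "'a ell2"
  show "cinner y x = cnj (cinner x y)" by (rule cinner_commute)
qed (auto simp: csubspace_def cinner_add_right cinner_scaleC_right cinner_self_norm)

interpretation H: hilbert_form UNIV cinner
  by (rule hilbert_form_cinner)

lemma H_pn: "H.pn x = norm x"
  by (simp add: H.pn_def cinner_self_norm)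

lemma dense_if_no_orthogonal:
  assumes "csubspace E" and "\<And>x. (\<And>z. z \<in> E \<Longrightarrow> cinner x z = 0) \<Longrightarrow> x = 0"
  shows "closure E = UNIV"
proof -
  have "H.pclosure E = UNIV"
    using assms by (intro H.dense_if_no_orthogonal) auto
  then have "\<exists>X. (\<forall>n. X n \<in> E) \<and> H.plim X x" for x
    by (auto simp: H.pclosure_def)
  then have "\<exists>X. (\<forall>n. X n \<in> E) \<and> X \<longlonglongrightarrow> x" for x
    using H.plim_norm[OF UNIV_I UNIV_I] by metis
  then show ?thesis
    by (auto simp: closure_sequential)
qed

subsection \<open>Adjoints\<close>

lemma adjoint_exists:
  fixes A :: "'a bop"
  assumes A: "\<And>c x. blinfun_apply A (scaleC c x) = scaleC c (blinfun_apply A x)"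
  shows "\<exists>B :: 'a bop. \<forall>x y. cinner (blinfun_apply B x) y = cinner x (blinfun_apply A y)"
proof -
  have "\<exists>b. \<forall>y. cinner b y = cinner x (blinfun_apply A y)" for x
  proof -
    have "\<exists>b\<in>UNIV. \<forall>y\<in>UNIV. cinner b y = cinner x (blinfun_apply A y)"
    proof (rule H.riesz)
      fix y
      have "cmod (cinner x (blinfun_apply A y)) \<le> norm x * norm (blinfun_apply A y)"
        by (rule cmod_cinner_le)
      also have "\<dots> \<le> norm x * (norm A * norm y)"
        by (intro mult_left_mono norm_blinfun) auto
      finally show "cmod (cinner x (blinfun_apply A y)) \<le> norm x * norm A * H.pn y"
        by (simp add: H_pn mult.assoc)
    qed (simp_all add: A blinfun.add_right cinner_add_right cinner_scaleC_right)
    then show ?thesis by auto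
  qed
  then obtain b where b: "\<And>x y. cinner (b x) y = cinner x (blinfun_apply A y)"
    by metis
  have "bounded_linear b"
  proof (rule bounded_linear_intro[where K = "norm A"])
    fix x y r
    show "b (x + y) = b x + b y"
      by (rule cinner_ext_left) (simp add: b cinner_add_left)
    show "b (r *\<^sub>R x) = r *\<^sub>R b x"
      by (rule cinner_ext_left) (simp add: b cinner_scaleR_left)
    have "(norm (b x))\<^sup>2 = cmod (cinner x (blinfun_apply A (b x)))"
      using arg_cong[OF b[of x "b x"], of cmod] by (simp add: cinner_self_norm norm_power)
    also have "\<dots> \<le> norm x * norm (blinfun_apply A (b x))"
      by (rule cmod_cinner_le)
    also have "\<dots> \<le> norm x * (norm A * norm (b x))"
      by (intro mult_left_mono norm_blinfun) auto
    finally show "norm (b x) \<le> norm x * norm A"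
      by (cases "norm (b x) = 0") (auto simp: power2_eq_square)
  qed
  then show ?thesis
    using b by (intro exI[of _ "Blinfun b"]) (simp add: bounded_linear_Blinfun_apply)
qed

lemma cinner_adj:
  fixes A :: "'a bop"
  assumes "\<And>c x. blinfun_apply A (scaleC c x) = scaleC c (blinfun_apply A x)"
  shows "cinner (blinfun_apply (adj A) x) y = cinner x (blinfun_apply A y)"
proof -
  have "\<exists>!B :: 'a bop. \<forall>x y. cinner (blinfun_apply B x) y = cinner x (blinfun_apply A y)"
    using adjoint_exists[OF assms]
    by (auto intro!: blinfun_eqI cinner_ext_left)
  from theI'[OF this] show ?thesis
    unfolding adj_def by blast
qed

subsection \<open>Hermitian operators between 0 and 1\<close>

definition hermitian_op :: "'a bop \<Rightarrow> bool" where
  "hermitian_op A \<longleftrightarrow> (\<forall>x y. cinner (blinfun_apply A x) y = cinner x (blinfun_apply A y))"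

text \<open>This says \<open>0 \<le> A \<le> 1\<close> for a Hermitian \<open>A\<close>. The two norm bounds are equivalent to the order
  relations, and they are what the iteration for the square root consumes.\<close>

definition effect :: "'a bop \<Rightarrow> bool" where
  "effect A \<longleftrightarrow> hermitian_op A \<and> norm A \<le> 1 \<and> norm (id_blinfun - A) \<le> 1"

lemma hermitianD: "hermitian_op A \<Longrightarrow> cinner (blinfun_apply A x) y = cinner x (blinfun_apply A y)"
  by (simp add: hermitian_op_def)

lemma effect_hermitian: "effect A \<Longrightarrow> hermitian_op A"
  by (simp add: effect_def)

lemmas effectD = hermitianD[OF effect_hermitian]

lemma hermitian_scaleC:
  "hermitian_op A \<Longrightarrow> blinfun_apply A (scaleC c x) = scaleC c (blinfun_apply A x)"
  by (rule cinner_ext_left) (simp add: hermitianD cinner_scaleC_left)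

lemma hermitian_complement: "hermitian_op A \<Longrightarrow> hermitian_op (id_blinfun - A)"
  by (simp add: hermitian_op_def blinfun.diff_left cinner.diff_left cinner.diff_right)

lemma effect_complement: "effect A \<Longrightarrow> effect (id_blinfun - A)"
  by (simp add: effect_def hermitian_complement)

lemma hermitian_diag_real: "hermitian_op A \<Longrightarrow> cinner x (blinfun_apply A x) \<in> \<real>"
  using cinner_commute[of x "blinfun_apply A x"] by (simp add: hermitianD Reals_cnj_iff)

lemma complex_nonneg_RealsI: "z \<in> \<real> \<Longrightarrow> 0 \<le> Re z \<Longrightarrow> z \<in> \<real>\<^sub>\<ge>\<^sub>0"
  by (simp add: complex_nonneg_Reals_iff complex_is_Real_iff)

lemma effect_nonneg:
  assumes "effect A"
  shows "cinner x (blinfun_apply A x) \<in> \<real>\<^sub>\<ge>\<^sub>0"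
proof (rule complex_nonneg_RealsI)
  show "cinner x (blinfun_apply A x) \<in> \<real>"
    using assms by (simp add: effect_def hermitian_diag_real)
  have "inner x (blinfun_apply (id_blinfun - A) x) \<le> norm x * norm (blinfun_apply (id_blinfun - A) x)"
    by (rule norm_cauchy_schwarz)
  also have "\<dots> \<le> norm x * (norm (id_blinfun - A) * norm x)"
    by (intro mult_left_mono norm_blinfun) auto
  also have "\<dots> \<le> norm x * (1 * norm x)"
    using assms by (intro mult_left_mono mult_right_mono) (auto simp: effect_def)
  finally show "0 \<le> Re (cinner x (blinfun_apply A x))"
    by (simp add: blinfun.diff_left inner_diff_right dot_square_norm power2_eq_square
        flip: inner_ell2_def)
qed

text \<open>Resolvents \<open>(1 + T)\<inverse>\<close> arise pointwise, as solution maps. Symmetry makes such a map linear, and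
  firm nonexpansiveness supplies both norm bounds.\<close>

lemma effect_of_symmetric_firmly_nonexpansive:
  assumes sym: "\<And>x y. cinner (b x) y = cinner x (b y)"
    and firm: "\<And>x. (norm (b x))\<^sup>2 \<le> Re (cinner x (b x))"
  shows "\<exists>B. effect B \<and> (\<forall>x. blinfun_apply B x = b x)"
proof -
  have le: "norm (b x) \<le> norm x" for x
  proof -
    have "(norm (b x))\<^sup>2 \<le> norm x * norm (b x)"
      using firm[of x] norm_cauchy_schwarz[of x "b x"] by (simp add: inner_ell2_def)
    then show ?thesis
      by (cases "norm (b x) = 0") (auto simp: power2_eq_square)
  qed
  have "bounded_linear b"
  proof (rule bounded_linear_intro[where K = 1])
    fix x y r
    show "b (x + y) = b x + b y"
      by (rule cinner_ext_left) (simp add: sym cinner_add_left)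
    show "b (r *\<^sub>R x) = r *\<^sub>R b x"
      by (rule cinner_ext_left) (simp add: sym cinner_scaleR_left)
    show "norm (b x) \<le> norm x * 1" using le by simp
  qed
  then have B: "blinfun_apply (Blinfun b) = b"
    by (rule bounded_linear_Blinfun_apply)
  have "norm (Blinfun b) \<le> 1"
    by (rule norm_blinfun_bound) (auto simp: B le)
  moreover have "norm (id_blinfun - Blinfun b) \<le> 1"
  proof (rule norm_blinfun_bound)
    fix x
    have "(norm (x - b x))\<^sup>2 = (norm x)\<^sup>2 - 2 * Re (cinner x (b x)) + (norm (b x))\<^sup>2"
      by (simp add: inner_ell2_def[symmetric] power2_norm_eq_inner inner_diff inner_commute)
    also have "\<dots> \<le> (norm x)\<^sup>2"
      using firm[of x] zero_le_power2[of "norm (b x)"] by linarith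
    finally have "norm (x - b x) \<le> norm x"
      by (rule power2_le_imp_le) simp
    then show "norm (blinfun_apply (id_blinfun - Blinfun b) x) \<le> 1 * norm x"
      by (simp add: B blinfun.diff_left)
  qed simp
  ultimately have "effect (Blinfun b)"
    using sym by (simp add: effect_def hermitian_op_def B)
  then show ?thesis using B by auto
qed

subsection \<open>The square root of a bounded operator\<close>

text \<open>With \<open>X = 1 - A\<close>, the operator \<open>1 - Z\<close> is a square root of \<open>A\<close> iff \<open>Z = (X + Z\<^sup>2) / 2\<close>. Iterating
  this equation from \<open>0\<close> gives operators whose increments are dominated in norm by those of the
  scalar iteration \<open>s \<mapsto> (1 + s\<^sup>2) / 2\<close>, which increases to a limit at most \<open>1\<close>; hence the iterates converge
  in operator norm. As the iterates are polynomials in \<open>A\<close>, the limit preserves every closed subspace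
  of \<open>H \<times> H\<close> that \<open>A \<times> A\<close> preserves. Graphs of operators commuting with \<open>A\<close>, bounded or
  not, are such subspaces.\<close>

lemma effect_sqrt_exists:
  fixes A :: "'a bop"
  assumes A: "effect A"
  shows "\<exists>C. effect C \<and> C o\<^sub>L C = A \<and>
    (\<forall>G. closed G \<and> subspace G \<and>
        (\<forall>x y. (x, y) \<in> G \<longrightarrow> (blinfun_apply A x, blinfun_apply A y) \<in> G) \<longrightarrow>
        (\<forall>x y. (x, y) \<in> G \<longrightarrow> (blinfun_apply C x, blinfun_apply C y) \<in> G))"
proof -
  define X where "X = id_blinfun - A"
  define Y where "Y = rec_nat (0 :: 'a bop) (\<lambda>_ Z. (1/2) *\<^sub>R (X + (Z o\<^sub>L Z)))"
  define y where "y = rec_nat (0 :: real) (\<lambda>_ s. (1 + s\<^sup>2) / 2)"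
  have Y0: "Y 0 = 0" and Y_Suc: "Y (Suc n) = (1/2) *\<^sub>R (X + (Y n o\<^sub>L Y n))" for n
    by (simp_all add: Y_def)
  have y0: "y 0 = 0" and y_Suc: "y (Suc n) = (1 + (y n)\<^sup>2) / 2" for n
    by (simp_all add: y_def)
  have normX: "norm X \<le> 1" and hX: "hermitian_op X"
    using effect_complement[OF A] by (simp_all add: effect_def X_def)
  have y_bounds: "0 \<le> y n \<and> y n \<le> 1" for n
  proof (induction n)
    case (Suc n)
    then have "(y n)\<^sup>2 \<le> 1" by (simp add: power_le_one)
    then show ?case by (simp add: y_Suc)
  qed (simp add: y0)
  have y_mono: "y n \<le> y (Suc n)" for n
    using zero_le_power2[of "1 - y n"] by (simp add: y_Suc power2_eq_square algebra_simps)
  have "convergent y"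
    using y_mono y_bounds by (intro Bseq_mono_convergent BseqI'[of _ 1]) (auto simp: lift_Suc_mono_le)
  then have "Cauchy y" by (rule convergent_Cauchy)
  have normY: "norm (Y n) \<le> y n" for n
  proof (induction n)
    case (Suc n)
    have "norm (X + (Y n o\<^sub>L Y n)) \<le> norm X + norm (Y n) * norm (Y n)"
      by (rule order_trans[OF norm_triangle_ineq add_left_mono[OF norm_blinfun_compose]])
    also have "\<dots> \<le> 1 + (y n)\<^sup>2"
      unfolding power2_eq_square using Suc y_bounds normX by (intro add_mono mult_mono) auto
    finally show ?case by (simp add: Y_Suc y_Suc)
  qed (simp add: Y0 y0)
  \<comment> \<open>the noncommutative difference of squares, \<open>W\<^sup>2 - V\<^sup>2 = W (W - V) + (W - V) V\<close>\<close>
  have difference: "(1/2) *\<^sub>R (X + (W o\<^sub>L W)) - (1/2) *\<^sub>R (X + (V o\<^sub>L V)) =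
      (1/2) *\<^sub>R ((W o\<^sub>L (W - V)) + ((W - V) o\<^sub>L V))" for W V :: "'a bop"
    by (rule blinfun_eqI)
      (simp add: blinfun.diff_left blinfun.diff_right blinfun.add_left blinfun.scaleR_left algebra_simps)
  have step: "norm (Y (Suc n) - Y n) \<le> y (Suc n) - y n" for n
  proof (induction n)
    case 0
    show ?case using normX by (simp add: Y_Suc y_Suc Y0 y0)
  next
    case (Suc n)
    let ?d = "Y (Suc n) - Y n"
    have eq: "Y (Suc (Suc n)) - Y (Suc n) = (1/2) *\<^sub>R ((Y (Suc n) o\<^sub>L ?d) + (?d o\<^sub>L Y n))"
      unfolding arg_cong2[OF Y_Suc[of "Suc n"] Y_Suc[of n], of "(-)"] by (rule difference)
    have "norm (Y (Suc (Suc n)) - Y (Suc n)) \<le>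
        (1/2) * (norm (Y (Suc n)) * norm ?d + norm ?d * norm (Y n))"
      unfolding eq
      by (simp add: order_trans[OF norm_triangle_ineq add_mono[OF norm_blinfun_compose norm_blinfun_compose]])
    also have "\<dots> \<le> (1/2) * (y (Suc n) * (y (Suc n) - y n) + (y (Suc n) - y n) * y n)"
      using Suc normY y_bounds y_mono by (intro mult_left_mono add_mono mult_mono) auto
    also have "\<dots> = y (Suc (Suc n)) - y (Suc n)"
      by (simp add: y_Suc[of "Suc n"] y_Suc[of n] power2_eq_square field_simps)
    finally show ?case .
  qed
  have dominated: "norm (Y m - Y n) \<le> y m - y n" if "n \<le> m" for m n
    using that
  proof (induction m rule: dec_induct)
    case (step m)
    have "norm (Y (Suc m) - Y n) \<le> norm (Y (Suc m) - Y m) + norm (Y m - Y n)"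
      using norm_triangle_ineq[of "Y (Suc m) - Y m" "Y m - Y n"] by simp
    then show ?case using step.IH \<open>norm (Y (Suc m) - Y m) \<le> _\<close> by simp
  qed simp
  have "Cauchy Y"
  proof (rule CauchyI')
    fix e :: real assume "e > 0"
    then obtain M where M: "\<forall>m\<ge>M. \<forall>n\<ge>M. norm (y m - y n) < e"
      using CauchyD[OF \<open>Cauchy y\<close>] by blast
    have "dist (Y m) (Y n) < e" if "m \<ge> M" "n > m" for m n
    proof -
      have "dist (Y m) (Y n) \<le> y n - y m"
        using dominated[of m n] that by (simp add: dist_norm norm_minus_commute)
      also have "\<dots> < e"
        using M[rule_format, of n m] that by simp
      finally show ?thesis .
    qed
    then show "\<exists>M. \<forall>m\<ge>M. \<forall>n>m. dist (Y m) (Y n) < e" by blast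
  qed
  then obtain Z where Z: "Y \<longlonglongrightarrow> Z"
    using Cauchy_convergent[of Y] by (auto simp: convergent_def)
  have Z_apply: "(\<lambda>n. blinfun_apply (Y n) x) \<longlonglongrightarrow> blinfun_apply Z x" for x
    by (intro blinfun.tendsto Z tendsto_const)
  have "(\<lambda>n. (1/2) *\<^sub>R (X + (Y n o\<^sub>L Y n))) \<longlonglongrightarrow> (1/2) *\<^sub>R (X + (Z o\<^sub>L Z))"
    by (intro tendsto_intros bounded_bilinear.tendsto[OF bounded_bilinear_blinfun_compose] Z)
  moreover have "(\<lambda>n. (1/2) *\<^sub>R (X + (Y n o\<^sub>L Y n))) \<longlonglongrightarrow> Z"
    using LIMSEQ_Suc[OF Z] by (simp add: Y_Suc)
  ultimately have Z_eq: "Z = (1/2) *\<^sub>R (X + (Z o\<^sub>L Z))"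
    using LIMSEQ_unique by blast
  have normZ: "norm Z \<le> 1"
  proof (rule tendsto_upperbound[OF tendsto_norm[OF Z]])
    have "norm (Y n) \<le> 1" for n using normY[of n] y_bounds[of n] by simp
    then show "\<forall>\<^sub>F n in sequentially. norm (Y n) \<le> 1" by simp
  qed simp
  have hermY: "hermitian_op (Y n)" for n
  proof (induction n)
    case (Suc n)
    then show ?case
      using hX by (simp add: hermitian_op_def Y_Suc blinfun.scaleR_left blinfun.add_left
          cinner_scaleR_left cinner_scaleR_right cinner_add_left cinner_add_right)
  qed (simp add: hermitian_op_def Y0 cinner.zero_left cinner.zero_right)
  then have "hermitian_op Z"
    unfolding hermitian_op_def[of Z]
  proof (intro allI)
    fix x y
    have "(\<lambda>n. cinner (blinfun_apply (Y n) x) y) \<longlonglongrightarrow> cinner (blinfun_apply Z x) y"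
      by (intro cinner.tendsto Z_apply tendsto_const)
    moreover have "(\<lambda>n. cinner x (blinfun_apply (Y n) y)) \<longlonglongrightarrow> cinner x (blinfun_apply Z y)"
      by (intro cinner.tendsto Z_apply tendsto_const)
    ultimately show "cinner (blinfun_apply Z x) y = cinner x (blinfun_apply Z y)"
      using hermY by (simp add: hermitianD LIMSEQ_unique)
  qed
  define C where "C = id_blinfun - Z"
  have hC: "hermitian_op C"
    unfolding C_def by (rule hermitian_complement) fact
  have square: "C o\<^sub>L C = A"
  proof (rule blinfun_eqI)
    fix x
    have "2 *\<^sub>R Z = X + (Z o\<^sub>L Z)"
      using arg_cong[OF Z_eq, of "\<lambda>F. 2 *\<^sub>R F"] by simp
    from arg_cong[OF this, of "\<lambda>F. blinfun_apply F x"]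
    have "2 *\<^sub>R blinfun_apply Z x = x - blinfun_apply A x + blinfun_apply Z (blinfun_apply Z x)"
      by (simp add: X_def blinfun.scaleR_left blinfun.add_left blinfun.diff_left)
    then show "blinfun_apply (C o\<^sub>L C) x = blinfun_apply A x"
      by (simp add: C_def blinfun.diff_left blinfun.diff_right scaleR_2 algebra_simps)
  qed
  have "norm C \<le> 1"
  proof (rule norm_blinfun_bound)
    fix x
    have "(norm (blinfun_apply C x))\<^sup>2 = inner x (blinfun_apply A x)"
      unfolding power2_norm_eq_inner inner_ell2_def square[symmetric] by (simp add: hermitianD[OF hC])
    also have "\<dots> \<le> norm x * (norm A * norm x)"
      by (rule order_trans[OF norm_cauchy_schwarz]) (intro mult_left_mono norm_blinfun norm_ge_zero)
    also have "\<dots> \<le> norm x * (1 * norm x)"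
      using A by (intro mult_left_mono mult_right_mono) (auto simp: effect_def)
    also have "\<dots> = (norm x)\<^sup>2" by (simp add: power2_eq_square)
    finally have "norm (blinfun_apply C x) \<le> norm x"
      by (rule power2_le_imp_le) simp
    then show "norm (blinfun_apply C x) \<le> 1 * norm x" by simp
  qed simp
  then have effC: "effect C"
    using hC normZ by (simp add: effect_def C_def)
  have invC: "(blinfun_apply C x, blinfun_apply C x') \<in> G"
    if G: "closed G" "subspace G" "\<And>x y. (x, y) \<in> G \<Longrightarrow> (blinfun_apply A x, blinfun_apply A y) \<in> G"
      and x: "(x, x') \<in> G" for G x x'
  proof -
    have XG: "(blinfun_apply X x, blinfun_apply X y) \<in> G" if "(x, y) \<in> G" for x y
      using subspace_diff[OF G(2) that G(3)[OF that]] by (simp add: X_def blinfun.diff_left)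
    have YG: "(blinfun_apply (Y n) x, blinfun_apply (Y n) y) \<in> G" if "(x, y) \<in> G" for n x y
      using that
    proof (induction n arbitrary: x y)
      case 0
      then show ?case using subspace_0[OF G(2)] by (simp add: Y0 zero_prod_def)
    next
      case (Suc n)
      have "(1/2) *\<^sub>R ((blinfun_apply X x, blinfun_apply X y) +
          (blinfun_apply (Y n) (blinfun_apply (Y n) x), blinfun_apply (Y n) (blinfun_apply (Y n) y))) \<in> G"
        by (intro subspace_scale subspace_add G(2) XG Suc)
      then show ?case by (simp add: Y_Suc blinfun.scaleR_left blinfun.add_left)
    qed
    have "(\<lambda>n. (blinfun_apply (Y n) x, blinfun_apply (Y n) x')) \<longlonglongrightarrow> (blinfun_apply Z x, blinfun_apply Z x')"
      by (intro tendsto_Pair Z_apply)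
    then have "(blinfun_apply Z x, blinfun_apply Z x') \<in> G"
      by (rule closed_sequentially[OF G(1) YG[OF x]])
    then show ?thesis
      using subspace_diff[OF G(2) x] by (auto simp: C_def blinfun.diff_left)
  qed
  show ?thesis
    using effC square by (intro exI[of _ C] conjI allI impI) (auto intro: invC)
qed

definition bsqrt :: "'a bop \<Rightarrow> 'a bop" where
  "bsqrt A = (SOME C. effect C \<and> C o\<^sub>L C = A \<and>
    (\<forall>G. closed G \<and> subspace G \<and>
        (\<forall>x y. (x, y) \<in> G \<longrightarrow> (blinfun_apply A x, blinfun_apply A y) \<in> G) \<longrightarrow>
        (\<forall>x y. (x, y) \<in> G \<longrightarrow> (blinfun_apply C x, blinfun_apply C y) \<in> G)))"

lemma effect_bsqrt: "effect A \<Longrightarrow> effect (bsqrt A)"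
  and bsqrt_square: "effect A \<Longrightarrow> blinfun_apply (bsqrt A) (blinfun_apply (bsqrt A) x) = blinfun_apply A x"
  and bsqrt_invariant: "effect A \<Longrightarrow> closed G \<Longrightarrow> subspace G \<Longrightarrow>
      (\<And>x y. (x, y) \<in> G \<Longrightarrow> (blinfun_apply A x, blinfun_apply A y) \<in> G) \<Longrightarrow> (u, v) \<in> G \<Longrightarrow>
      (blinfun_apply (bsqrt A) u, blinfun_apply (bsqrt A) v) \<in> G"
proof -
  assume "effect A"
  note * = someI_ex[OF effect_sqrt_exists[OF this], folded bsqrt_def]
  show "effect (bsqrt A)" by (rule *[THEN conjunct1])
  have "bsqrt A o\<^sub>L bsqrt A = A" by (rule *[THEN conjunct2, THEN conjunct1])
  then show "blinfun_apply (bsqrt A) (blinfun_apply (bsqrt A) x) = blinfun_apply A x"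
    by (metis blinfun_apply_blinfun_compose)
  show "(blinfun_apply (bsqrt A) u, blinfun_apply (bsqrt A) v) \<in> G"
    if "closed G" "subspace G" "(u, v) \<in> G"
      "\<And>x y. (x, y) \<in> G \<Longrightarrow> (blinfun_apply A x, blinfun_apply A y) \<in> G"
    using *[THEN conjunct2, THEN conjunct2, rule_format, of G u v] that by simp
qed

lemma bsqrt_commute:
  assumes A: "effect A"
    and F: "\<And>x. blinfun_apply A (blinfun_apply F x) = blinfun_apply F (blinfun_apply A x)"
  shows "blinfun_apply (bsqrt A) (blinfun_apply F x) = blinfun_apply F (blinfun_apply (bsqrt A) x)"
proof -
  define G where "G = {z. snd z = blinfun_apply F (fst z)}"
  have "closed G"
    unfolding G_def by (intro closed_Collect_eq continuous_intros)
  moreover have "subspace G"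
    by (auto simp: subspace_def G_def blinfun.add_right blinfun.scaleR_right)
  ultimately have "(blinfun_apply (bsqrt A) x, blinfun_apply (bsqrt A) (blinfun_apply F x)) \<in> G"
    by (rule bsqrt_invariant[OF A]) (auto simp: G_def F)
  then show ?thesis by (simp add: G_def)
qed

text \<open>The square root turns the vanishing of the quadratic form into \<open>\<parallel>\<surd>A x\<parallel> = 0\<close>.\<close>

lemma effect_kernel:
  assumes A: "effect A" and "cinner x (blinfun_apply A x) = 0"
  shows "blinfun_apply A x = 0"
proof -
  have "cinner (blinfun_apply (bsqrt A) x) (blinfun_apply (bsqrt A) x) = 0"
    using assms(2) by (simp add: effectD[OF effect_bsqrt[OF A]] bsqrt_square[OF A])
  then have "blinfun_apply (bsqrt A) x = 0"
    by (simp add: cinner_self_norm)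
  then show ?thesis
    using bsqrt_square[OF A, of x] by (simp add: blinfun.zero_right)
qed

section \<open>Unbounded self-adjoint operators\<close>

lemma single_valuedI2: "(\<And>x y z. (x, y) \<in> T \<Longrightarrow> (x, z) \<in> T \<Longrightarrow> y = z) \<Longrightarrow> single_valued T"
  by (auto simp: single_valued_def)

lemma uop_apply_eq: "single_valued T \<Longrightarrow> (x, y) \<in> T \<Longrightarrow> uop_apply T x = y"
  unfolding uop_apply_def by (rule the_equality) (auto dest: single_valuedD)

lemma linear_uop_add: "linear_uop T \<Longrightarrow> (x, y) \<in> T \<Longrightarrow> (x', y') \<in> T \<Longrightarrow> (x + x', y + y') \<in> T"
  and linear_uop_scaleC: "linear_uop T \<Longrightarrow> (x, y) \<in> T \<Longrightarrow> (scaleC c x, scaleC c y) \<in> T"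
  and linear_uop_single_valued: "linear_uop T \<Longrightarrow> single_valued T"
  and linear_uop_zero: "linear_uop T \<Longrightarrow> (0, 0) \<in> T"
  by (fastforce simp: linear_uop_def)+

lemma linear_uop_diff: "linear_uop T \<Longrightarrow> (x, y) \<in> T \<Longrightarrow> (x', y') \<in> T \<Longrightarrow> (x - x', y - y') \<in> T"
  using linear_uop_add[of T x y "- x'" "- y'"] linear_uop_scaleC[of T x' y' "-1"]
  by (simp add: scaleC_minus_one)

lemma linear_uop_subspace: "linear_uop T \<Longrightarrow> subspace T"
  using linear_uop_scaleC[of T _ _ "of_real r" for r]
  by (auto simp: subspace_def zero_prod_def linear_uop_zero linear_uop_add scaleC_of_real)

lemma linear_uop_csubspace_Domain: "linear_uop T \<Longrightarrow> csubspace (Domain T)"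
  unfolding csubspace_def Domain_iff
  by (blast intro: linear_uop_add linear_uop_scaleC linear_uop_zero)

lemma selfadjoint_linear: "selfadjoint_uop T \<Longrightarrow> linear_uop T"
  by (simp add: selfadjoint_uop_def)

lemma selfadjoint_mem_iff:
  "selfadjoint_uop T \<Longrightarrow> (y, z) \<in> T \<longleftrightarrow> (\<forall>x w. (x, w) \<in> T \<longrightarrow> cinner y w = cinner z x)"
  by (subst selfadjoint_uop_def[THEN iffD1, THEN conjunct2, THEN conjunct2, symmetric])
    (auto simp: uop_adj_def)

lemma selfadjoint_symmetric:
  "selfadjoint_uop T \<Longrightarrow> (y, z) \<in> T \<Longrightarrow> (x, w) \<in> T \<Longrightarrow> cinner y w = cinner z x"
  using selfadjoint_mem_iff by blast

lemma selfadjoint_closed: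
  assumes "selfadjoint_uop T"
  shows "closed T"
proof -
  have "T = (\<Inter>p\<in>T. {q. cinner (fst q) (snd p) = cinner (snd q) (fst p)})"
  proof (rule set_eqI)
    fix q
    show "q \<in> T \<longleftrightarrow> q \<in> (\<Inter>p\<in>T. {q. cinner (fst q) (snd p) = cinner (snd q) (fst p)})"
      using selfadjoint_mem_iff[OF assms, of "fst q" "snd q"] by fastforce
  qed
  moreover have "closed (\<Inter>p\<in>T. {q. cinner (fst q) (snd p) = cinner (snd q) (fst p)})"
    by (intro closed_INT ballI closed_Collect_eq cinner.continuous_on continuous_intros)
  ultimately show ?thesis by simp
qed

text \<open>Taking adjoints reverses inclusions, so an inclusion between self-adjoint operators is an
  equality.\<close>

lemma selfadjoint_subset_eq:
  assumes "selfadjoint_uop S" "selfadjoint_uop T" "S \<subseteq> T"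
  shows "S = T"
proof (intro equalityI assms(3) subrelI)
  fix y z assume "(y, z) \<in> T"
  then have "cinner y w = cinner z x" if "(x, w) \<in> S" for x w
    using selfadjoint_symmetric[OF assms(2)] assms(3) that by blast
  then show "(y, z) \<in> S" unfolding selfadjoint_mem_iff[OF assms(1), of y z] by blast
qed

lemma positive_selfadjointD:
  "positive_selfadjoint T \<Longrightarrow> selfadjoint_uop T"
  "positive_selfadjoint T \<Longrightarrow> (x, y) \<in> T \<Longrightarrow> cinner x y \<in> \<real>\<^sub>\<ge>\<^sub>0"
  by (auto simp: positive_selfadjoint_def)

subsection \<open>Operators given by a pair of bounded operators\<close>

text \<open>For injective \<open>P\<close> this is the graph of the unbounded operator \<open>Q P\<inverse>\<close>.\<close>

definition pair_graph :: "'a bop \<Rightarrow> 'a bop \<Rightarrow> 'a uop" where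
  "pair_graph P Q = range (\<lambda>y. (blinfun_apply P y, blinfun_apply Q y))"

lemma pair_graph_mem: "(blinfun_apply P y, blinfun_apply Q y) \<in> pair_graph P Q"
  by (auto simp: pair_graph_def)

lemma csubspace_range:
  assumes "hermitian_op P"
  shows "csubspace (range (blinfun_apply P))"
proof -
  have "0 \<in> range (blinfun_apply P)" by (rule range_eqI[of _ _ 0]) (simp add: blinfun.zero_right)
  then show ?thesis
    by (auto simp: csubspace_def simp flip: hermitian_scaleC[OF assms] blinfun.add_right)
qed

lemma dense_range_if_injective:
  assumes P: "hermitian_op P" and inj: "\<And>y. blinfun_apply P y = 0 \<Longrightarrow> y = 0"
  shows "closure (range (blinfun_apply P)) = UNIV"
proof (rule dense_if_no_orthogonal)
  show "csubspace (range (blinfun_apply P))" by (rule csubspace_range[OF P])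
  fix x assume "\<And>z. z \<in> range (blinfun_apply P) \<Longrightarrow> cinner x z = 0"
  then have "cinner (blinfun_apply P x) z = cinner 0 z" for z
    by (simp add: hermitianD[OF P] cinner.zero_left)
  then have "blinfun_apply P x = 0" by (rule cinner_ext_left)
  then show "x = 0" by (rule inj)
qed

text \<open>A pair \<open>(u, v)\<close> lies in the adjoint of the graph iff \<open>Q u = P v\<close>. A relation \<open>X P + Y Q = 1\<close> with
  coefficients commuting with \<open>P\<close> and \<open>Q\<close> then exhibits \<open>(u, v)\<close> as the point of the graph with
  parameter \<open>X u + Y v\<close>.\<close>

lemma pair_graph_selfadjoint:
  fixes P Q X Y :: "'a bop"
  assumes P: "hermitian_op P" and Q: "hermitian_op Q"
    and inj: "\<And>y. blinfun_apply P y = 0 \<Longrightarrow> y = 0"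
    and PQ: "\<And>y. blinfun_apply P (blinfun_apply Q y) = blinfun_apply Q (blinfun_apply P y)"
    and XP: "\<And>y. blinfun_apply P (blinfun_apply X y) = blinfun_apply X (blinfun_apply P y)"
    and XQ: "\<And>y. blinfun_apply Q (blinfun_apply X y) = blinfun_apply X (blinfun_apply Q y)"
    and YP: "\<And>y. blinfun_apply P (blinfun_apply Y y) = blinfun_apply Y (blinfun_apply P y)"
    and YQ: "\<And>y. blinfun_apply Q (blinfun_apply Y y) = blinfun_apply Y (blinfun_apply Q y)"
    and bezout: "\<And>y. blinfun_apply X (blinfun_apply P y) + blinfun_apply Y (blinfun_apply Q y) = y"
  shows "selfadjoint_uop (pair_graph P Q)"
    and "(u, v) \<in> pair_graph P Q \<longleftrightarrow> blinfun_apply Q u = blinfun_apply P v"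
proof -
  have mem: "(u, v) \<in> pair_graph P Q \<longleftrightarrow> blinfun_apply Q u = blinfun_apply P v" for u v
  proof
    assume "(u, v) \<in> pair_graph P Q"
    then show "blinfun_apply Q u = blinfun_apply P v" by (auto simp: pair_graph_def PQ)
  next
    assume *: "blinfun_apply Q u = blinfun_apply P v"
    define y where "y = blinfun_apply X u + blinfun_apply Y v"
    have "blinfun_apply P y = u"
      using bezout[of u] by (simp add: y_def blinfun.add_right XP YP *)
    moreover have "blinfun_apply Q y = v"
      using bezout[of v] by (simp add: y_def blinfun.add_right XQ YQ *)
    ultimately show "(u, v) \<in> pair_graph P Q"
      using pair_graph_mem[of P y Q] by simp
  qed
  then show "(u, v) \<in> pair_graph P Q \<longleftrightarrow> blinfun_apply Q u = blinfun_apply P v" .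
  have "linear_uop (pair_graph P Q)"
    unfolding linear_uop_def
  proof (intro conjI)
    show "single_valued (pair_graph P Q)"
    proof (rule single_valuedI2)
      fix x y z assume "(x, y) \<in> pair_graph P Q" "(x, z) \<in> pair_graph P Q"
      then have "blinfun_apply P (y - z) = 0" by (simp add: mem blinfun.diff_right)
      then show "y = z" using inj by fastforce
    qed
  qed (auto simp: mem blinfun.zero_right blinfun.add_right hermitian_scaleC P Q)
  moreover have "Domain (pair_graph P Q) = range (blinfun_apply P)"
    by (auto simp: pair_graph_def)
  moreover have "uop_adj (pair_graph P Q) = pair_graph P Q"
  proof (intro equalityI subrelI)
    fix a b assume "(a, b) \<in> uop_adj (pair_graph P Q)"
    then have "cinner (blinfun_apply Q a) y = cinner (blinfun_apply P b) y" for y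
      using pair_graph_mem[of P y Q] by (auto simp: uop_adj_def hermitianD[OF P] hermitianD[OF Q])
    then show "(a, b) \<in> pair_graph P Q"
      unfolding mem by (rule cinner_ext_left)
  next
    fix a b assume "(a, b) \<in> pair_graph P Q"
    then have "cinner a (blinfun_apply Q y) = cinner b (blinfun_apply P y)" for y
      unfolding mem by (metis hermitianD[OF P] hermitianD[OF Q])
    then show "(a, b) \<in> uop_adj (pair_graph P Q)"
      by (auto simp: uop_adj_def pair_graph_def)
  qed
  ultimately show "selfadjoint_uop (pair_graph P Q)"
    using dense_range_if_injective[OF P inj] by (simp add: selfadjoint_uop_def)
qed

subsection \<open>The square root of an unbounded operator\<close>

text \<open>\<open>B\<close> plays the role of \<open>(1 + T)\<inverse>\<close>; then \<open>T = (1 - B) B\<inverse>\<close>, and the square root of \<open>T\<close> is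
  \<open>\<surd>(1 - B) (\<surd>B)\<inverse>\<close>.\<close>

locale resolvent =
  fixes B :: "'a bop"
  assumes effect: "effect B" and injective: "\<And>y. blinfun_apply B y = 0 \<Longrightarrow> y = 0"
begin

abbreviation "b \<equiv> blinfun_apply B"
abbreviation "C \<equiv> bsqrt B"
abbreviation "D \<equiv> bsqrt (id_blinfun - B)"
abbreviation "c \<equiv> blinfun_apply C"
abbreviation "d \<equiv> blinfun_apply D"

definition T :: "'a uop" where "T = pair_graph B (id_blinfun - B)"
definition S :: "'a uop" where "S = pair_graph C D"

lemma effect_B': "effect (id_blinfun - B)" by (rule effect_complement) (rule effect)
lemma effect_C: "effect C" by (rule effect_bsqrt) (rule effect)
lemma effect_D: "effect D" by (rule effect_bsqrt) (rule effect_B')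

lemma cc: "c (c x) = b x" by (rule bsqrt_square[OF effect])
lemma dd: "d (d x) = x - b x" using bsqrt_square[OF effect_B', of x] by (simp add: blinfun.diff_left)

lemma c_injective: "c y = 0 \<Longrightarrow> y = 0"
  using injective[of y] by (simp add: cc[symmetric] blinfun.zero_right)

lemma c_b: "c (b x) = b (c x)" by (rule bsqrt_commute[OF effect]) simp

lemma d_commute:
  assumes "\<And>x. b (blinfun_apply F x) = blinfun_apply F (b x)"
  shows "d (blinfun_apply F x) = blinfun_apply F (d x)"
  by (rule bsqrt_commute[OF effect_B']) (simp add: blinfun.diff_left blinfun.diff_right assms)

lemma d_c: "d (c x) = c (d x)" by (rule d_commute) (simp add: c_b)
lemma d_b: "d (b x) = b (d x)" by (rule d_commute) simp

lemma T_selfadjoint: "selfadjoint_uop T"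
  unfolding T_def
  by (rule pair_graph_selfadjoint[of _ _ id_blinfun id_blinfun])
    (simp_all add: effect_hermitian effect effect_B' injective blinfun.diff_left blinfun.diff_right)

lemma S_selfadjoint: "selfadjoint_uop S"
  and S_mem: "(u, v) \<in> S \<longleftrightarrow> d u = c v"
proof -
  have *: "c (c y) + d (d y) = y" for y by (simp add: cc dd)
  note p = pair_graph_selfadjoint[OF effect_hermitian[OF effect_C] effect_hermitian[OF effect_D]
      c_injective d_c[symmetric] refl d_c d_c[symmetric] refl *]
  show "selfadjoint_uop S" unfolding S_def by (rule p(1))
  show "(u, v) \<in> S \<longleftrightarrow> d u = c v" unfolding S_def by (rule p(2))
qed

lemma T_mem: "(b y, y - b y) \<in> T"
  using pair_graph_mem[of B y "id_blinfun - B"] by (simp add: T_def blinfun.diff_left)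

lemma T_cases:
  assumes "(u, v) \<in> T" obtains y where "u = b y" "v = y - b y"
  using assms by (auto simp: T_def pair_graph_def blinfun.diff_left)

lemma T_positive: "positive_selfadjoint T"
  unfolding positive_selfadjoint_def
proof (intro conjI T_selfadjoint, clarify)
  fix u v assume "(u, v) \<in> T"
  then obtain y where y: "u = b y" "v = y - b y" by (rule T_cases)
  have "cinner u v = cinner (c y) (c (y - b y))"
    unfolding y cc[symmetric, of y] by (rule effectD[OF effect_C])
  also have "c (y - b y) = blinfun_apply (id_blinfun - B) (c y)"
    by (simp add: blinfun.diff_left blinfun.diff_right c_b)
  finally show "cinner u v \<in> \<real>\<^sub>\<ge>\<^sub>0"
    by (simp add: effect_nonneg[OF effect_B'] del: blinfun.diff_left)
qed

text \<open>Positivity of \<open>\<surd>(1 - B) (\<surd>B)\<inverse>\<close> comes from splitting \<open>\<surd>B\<close> into the square of its own square root.\<close>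

lemma S_positive: "positive_selfadjoint S"
  unfolding positive_selfadjoint_def
proof (intro conjI S_selfadjoint, clarify)
  fix u v assume "(u, v) \<in> S"
  then obtain y where y: "u = c y" "v = d y" by (auto simp: S_def pair_graph_def)
  define e where "e = blinfun_apply (bsqrt C)"
  have "d (c x) = c (d x)" for x by (rule d_c)
  then have ed: "e (d x) = d (e x)" for x
    unfolding e_def by (intro bsqrt_commute[OF effect_C]) simp
  have "cinner u v = cinner (e (e y)) (d y)"
    by (simp add: y e_def bsqrt_square[OF effect_C])
  also have "\<dots> = cinner (e y) (d (e y))"
    by (simp add: e_def effectD[OF effect_bsqrt[OF effect_C]] ed[unfolded e_def])
  finally show "cinner u v \<in> \<real>\<^sub>\<ge>\<^sub>0"
    by (simp add: effect_nonneg[OF effect_D])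
qed

lemma S_square: "S O S = T"
proof (intro equalityI subrelI)
  fix x z assume "(x, z) \<in> S O S"
  then obtain w where w: "(x, w) \<in> S" "(w, z) \<in> S" by blast
  then obtain y where y: "x = c y" "w = d y" by (auto simp: S_def pair_graph_def)
  obtain y' where y': "w = c y'" "z = d y'" using w(2) by (auto simp: S_def pair_graph_def)
  \<comment> \<open>As \<open>\<surd>B \<surd>B + \<surd>(1 - B) \<surd>(1 - B) = 1\<close>, this is the only candidate for a vector with \<open>c u = y\<close> and
    \<open>d u = y'\<close>.\<close>
  define u where "u = c y + d y'"
  have "c u = c (c y) + d (c y')"
    by (simp add: u_def blinfun.add_right d_c)
  also have "\<dots> = y"
    unfolding y'(1)[symmetric] y(2) by (simp add: cc dd)
  finally have cu: "c u = y" .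
  have "d u = c (d y) + d (d y')"
    by (simp add: u_def blinfun.add_right d_c)
  also have "\<dots> = y'"
    unfolding y(2)[symmetric] y'(1) by (simp add: cc dd)
  finally have du: "d u = y'" .
  have "x = b u" "z = u - b u"
    by (simp_all add: y(1) y'(2) cu[symmetric] du[symmetric] cc dd)
  then show "(x, z) \<in> T" using T_mem by simp
next
  fix x z assume "(x, z) \<in> T"
  then obtain u where u: "x = b u" "z = u - b u" by (rule T_cases)
  have "(c (c u), d (c u)) \<in> S" "(c (d u), d (d u)) \<in> S"
    by (simp_all add: S_def pair_graph_mem)
  then show "(x, z) \<in> S O S"
    by (auto simp: u cc dd d_c)
qed

text \<open>Let \<open>R\<close> be another positive square root of \<open>T\<close>. It commutes with \<open>B\<close>, hence with \<open>\<surd>B\<close> and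
  \<open>\<surd>(1 - B)\<close>. The proof that \<open>R = S\<close> transports the classical argument for bounded operators: with
  \<open>k = d u - c (R u)\<close>, formally \<open>(\<surd>(1 - B) - R \<surd>B) u\<close>, one has \<open>(\<surd>(1 - B) + R \<surd>B) k = 0\<close>. Both
  summands are positive, so both kill \<open>k\<close>, and then \<open>k\<close> is orthogonal to itself. Only vectors in the
  range of \<open>B\<close> admit this computation directly; injectivity of \<open>B\<close> carries its conclusion to all of
  the domain of \<open>R\<close>.\<close>

lemma S_unique:
  assumes R: "positive_selfadjoint R" and RR: "R O R = T"
  shows "R = S"
proof -
  have sa: "selfadjoint_uop R" by (rule positive_selfadjointD(1)[OF R])
  note lin = selfadjoint_linear[OF sa]
  note sym = selfadjoint_symmetric[OF sa]
  note closed_R = selfadjoint_closed[OF sa] linear_uop_subspace[OF lin]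
  have factor: "\<exists>w. (b t, w) \<in> R \<and> (w, t - b t) \<in> R" for t
    using T_mem[of t] RR by blast
  have bR: "(b x, b y) \<in> R" if "(x, y) \<in> R" for x y
  proof -
    obtain w where w: "(b x, w) \<in> R" "(w, x - b x) \<in> R" using factor by blast
    have "(x - b x, y - w) \<in> R" by (rule linear_uop_diff[OF lin that w(1)])
    with w(2) have "(w, y - w) \<in> T" using RR by blast
    then obtain t where "w = b t" "y - w = t - b t" by (rule T_cases)
    then have "w = b y" by simp
    with w(1) show ?thesis by simp
  qed
  have cR: "(c x, c y) \<in> R" if "(x, y) \<in> R" for x y
    by (rule bsqrt_invariant[OF effect closed_R bR that])
  have dR: "(d x, d y) \<in> R" if "(x, y) \<in> R" for x y
  proof (rule bsqrt_invariant[OF effect_B' closed_R _ that])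
    fix x y assume "(x, y) \<in> R"
    then show "(blinfun_apply (id_blinfun - B) x, blinfun_apply (id_blinfun - B) y) \<in> R"
      using linear_uop_diff[OF lin _ bR] by (simp add: blinfun.diff_left)
  qed
  have pos: "cinner k (c l) \<in> \<real>\<^sub>\<ge>\<^sub>0" if "(k, l) \<in> R" for k l
  proof -
    have "(blinfun_apply (bsqrt C) k, blinfun_apply (bsqrt C) l) \<in> R"
      by (rule bsqrt_invariant[OF effect_C closed_R cR that])
    from positive_selfadjointD(2)[OF R this] show ?thesis
      by (simp add: effectD[OF effect_bsqrt[OF effect_C]] bsqrt_square[OF effect_C])
  qed
  have on_range: "d (b t) = c w" if w: "(b t, w) \<in> R" for t w
  proof -
    define u where "u = b t"
    have w': "(w, t - u) \<in> R"
      using factor[of t] w single_valuedD[OF linear_uop_single_valued[OF lin]]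
      unfolding u_def by blast
    define k where "k = d u - c w"
    define l where "l = d w - c (t - u)"
    have kl: "(k, l) \<in> R"
      unfolding k_def l_def using w by (intro linear_uop_diff[OF lin] dR cR w') (simp add: u_def)
    have sum0: "d k + c l = 0"
      unfolding k_def l_def by (simp add: blinfun.diff_right dd cc d_c) (simp add: u_def)
    have "cinner k (d k) + cinner k (c l) = 0"
      using arg_cong[OF sum0, of "cinner k"] by (simp add: cinner_add_right cinner.zero_right)
    then have "cinner k (d k) = 0" "cinner k (c l) = 0"
      using effect_nonneg[OF effect_D, of k] pos[OF kl]
      by (auto simp: complex_nonneg_Reals_iff complex_eq_iff)
    then have dk: "d k = 0" by (intro effect_kernel[OF effect_D])
    then have "l = 0" using sum0 c_injective by simp
    then have "(c k, 0) \<in> R" using cR[OF kl] by (simp add: blinfun.zero_right)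
    then have "cinner (c k) w = 0"
      using sym[of "c k" 0 u w] w by (simp add: u_def cinner.zero_left)
    then have "cinner k (c w) = 0" by (simp add: effectD[OF effect_C])
    moreover have "cinner k (d u) = cinner (d k) u" by (simp add: effectD[OF effect_D])
    ultimately have "cinner k (d u - c w) = 0"
      using dk by (simp add: cinner.diff_right cinner.zero_left)
    then have "cinner k k = 0" by (simp add: k_def)
    then show ?thesis by (simp add: k_def cinner_self_norm u_def)
  qed
  have "R \<subseteq> S"
  proof (rule subrelI)
    fix u v assume "(u, v) \<in> R"
    then have "d (b u) = c (b v)" by (intro on_range bR)
    then have "b (d u - c v) = 0" by (simp add: d_b c_b blinfun.diff_right)
    then show "(u, v) \<in> S" using injective unfolding S_mem by fastforce
  qed
  then show ?thesis by (rule selfadjoint_subset_eq[OF sa S_selfadjoint])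
qed

lemma sqrt_T: "uop_sqrt T = S"
  unfolding uop_sqrt_def
proof (rule the_equality)
  show "positive_selfadjoint S \<and> S O S = T" by (rule conjI[OF S_positive S_square])
  show "R = S" if "positive_selfadjoint R \<and> R O R = T" for R
    using that S_unique by blast
qed

end

text \<open>The resolvent \<open>(1 + T)\<inverse>\<close> of a positive self-adjoint \<open>T\<close> exists everywhere: \<open>\<parallel>x + T x\<parallel>\<close> is a complete
  Hilbert norm on the domain, so the functional \<open>z \<mapsto> \<langle>y, z + T z\<rangle>\<close> is represented by some \<open>x\<close>, and the
  defect \<open>v = x + T x - y\<close> is orthogonal to the range of \<open>1 + T\<close>. Hence \<open>T v = - v\<close>, and positivity forces
  \<open>v = 0\<close>.\<close>

lemma resolvent_solves:
  assumes T: "positive_selfadjoint T"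
  shows "\<exists>x. (x, y - x) \<in> T"
proof -
  have sa: "selfadjoint_uop T" by (rule positive_selfadjointD(1)[OF T])
  note lin = selfadjoint_linear[OF sa]
  define t where "t = uop_apply T"
  have t: "(x, t x) \<in> T" if "x \<in> Domain T" for x
    using that uop_apply_eq[OF linear_uop_single_valued[OF lin]] by (auto simp: t_def)
  have t_eq: "t x = z" if "(x, z) \<in> T" for x z
    unfolding t_def by (rule uop_apply_eq[OF linear_uop_single_valued[OF lin] that])
  have t_add: "t (x + z) = t x + t z" if "x \<in> Domain T" "z \<in> Domain T" for x z
    by (rule t_eq) (rule linear_uop_add[OF lin t[OF that(1)] t[OF that(2)]])
  have t_diff: "t (x - z) = t x - t z" if "x \<in> Domain T" "z \<in> Domain T" for x z
    by (rule t_eq) (rule linear_uop_diff[OF lin t[OF that(1)] t[OF that(2)]])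
  have t_scale: "t (scaleC c x) = scaleC c (t x)" if "x \<in> Domain T" for c x
    by (rule t_eq) (rule linear_uop_scaleC[OF lin t[OF that]])
  have bound: "(norm x)\<^sup>2 + (norm (t x))\<^sup>2 \<le> (norm (x + t x))\<^sup>2" if "x \<in> Domain T" for x
  proof -
    have "0 \<le> inner x (t x)"
      using positive_selfadjointD(2)[OF T t[OF that]]
      by (simp add: inner_ell2_def complex_nonneg_Reals_iff)
    moreover have "(norm (x + t x))\<^sup>2 = (norm x)\<^sup>2 + 2 * inner x (t x) + (norm (t x))\<^sup>2"
      by (simp add: power2_norm_eq_inner inner_add_left inner_add_right inner_commute)
    ultimately show ?thesis by linarith
  qed
  have bound1: "norm x \<le> norm (x + t x)" and bound2: "norm (t x) \<le> norm (x + t x)"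
    if "x \<in> Domain T" for x
  proof -
    have "(norm x)\<^sup>2 \<le> (norm (x + t x))\<^sup>2" "(norm (t x))\<^sup>2 \<le> (norm (x + t x))\<^sup>2"
      using bound[OF that] zero_le_power2[of "norm x"] zero_le_power2[of "norm (t x)"] by linarith+
    then show "norm x \<le> norm (x + t x)" "norm (t x) \<le> norm (x + t x)"
      by (auto elim: power2_le_imp_le)
  qed
  define p where "p x z = cinner (x + t x) (z + t z)" for x z
  interpret P: hilbert_form "Domain T" p
  proof
    show "csubspace (Domain T)" by (rule linear_uop_csubspace_Domain[OF lin])
    show "p z x = cnj (p x z)" for x z unfolding p_def by (rule cinner_commute)
    show "(norm x)\<^sup>2 \<le> Re (p x x)" if "x \<in> Domain T" for x
      using power_mono[OF bound1[OF that], of 2] by (simp add: p_def cinner_self_norm)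
    fix X :: "nat \<Rightarrow> 'a ell2"
    assume X: "\<And>n. X n \<in> Domain T"
      and "\<And>e. e > 0 \<Longrightarrow> \<exists>N. \<forall>m\<ge>N. \<forall>n\<ge>N. sqrt (Re (p (X m - X n) (X m - X n))) < e"
    then have *: "\<And>e. e > 0 \<Longrightarrow> \<exists>N. \<forall>m\<ge>N. \<forall>n\<ge>N. norm (X m - X n + t (X m - X n)) < e"
      by (simp add: p_def cinner_self_norm)
    have diff: "X m - X n \<in> Domain T" for m n
      using linear_uop_diff[OF lin t[OF X] t[OF X]] by blast
    have "Cauchy X"
      unfolding Cauchy_iff using * bound1[OF diff] by (meson order_le_less_trans)
    moreover have "Cauchy (\<lambda>n. t (X n))"
      unfolding Cauchy_iff t_diff[OF X X, symmetric]
      using * bound2[OF diff] by (meson order_le_less_trans)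
    ultimately obtain x z where x: "X \<longlonglongrightarrow> x" and z: "(\<lambda>n. t (X n)) \<longlonglongrightarrow> z"
      using Cauchy_convergent[of X] Cauchy_convergent[of "\<lambda>n. t (X n)"] by (auto simp: convergent_def)
    have xz: "(x, z) \<in> T"
      by (rule closed_sequentially[OF selfadjoint_closed[OF sa], of "\<lambda>n. (X n, t (X n))"])
        (intro t X tendsto_Pair x z)+
    then have xD: "x \<in> Domain T" by blast
    have "(\<lambda>n. norm (X n - x + (t (X n) - z))) \<longlonglongrightarrow> norm (x - x + (z - z))"
      by (intro tendsto_intros x z)
    then show "\<exists>x\<in>Domain T. (\<lambda>n. sqrt (Re (p (X n - x) (X n - x)))) \<longlonglongrightarrow> 0"
      using xD by (intro bexI[of _ x]) (simp_all add: p_def cinner_self_norm t_diff[OF X xD] t_eq[OF xz])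
  qed (auto simp: p_def t_add t_scale cinner_add_right cinner_scaleC_right algebra_simps)
  have "\<exists>x\<in>Domain T. \<forall>z\<in>Domain T. p x z = cinner y (z + t z)"
  proof (rule P.riesz)
    fix z assume "z \<in> Domain T"
    show "cmod (cinner y (z + t z)) \<le> norm y * P.pn z"
      using cmod_cinner_le[of y "z + t z"] by (simp add: P.pn_def p_def cinner_self_norm)
  qed (auto simp: t_add t_scale cinner_add_right cinner_scaleC_right algebra_simps)
  then obtain x where x: "x \<in> Domain T"
    and *: "\<And>z. z \<in> Domain T \<Longrightarrow> cinner (x + t x) (z + t z) = cinner y (z + t z)"
    by (auto simp: p_def)
  define v where "v = x + t x - y"
  have "(v, - v) \<in> T"
  proof (rule selfadjoint_mem_iff[OF sa, THEN iffD2], intro allI impI)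
    fix z w assume zw: "(z, w) \<in> T"
    have "cinner v (z + w) = 0"
      using *[of z] zw t_eq[OF zw] by (auto simp: v_def cinner.diff_left)
    then show "cinner v w = cinner (- v) z"
      by (simp add: cinner_add_right cinner.minus_left eq_neg_iff_add_eq_0 add.commute)
  qed
  from positive_selfadjointD(2)[OF T this] have "v = 0"
    by (simp add: cinner.minus_right cinner_self_norm complex_nonneg_Reals_iff)
  then have "t x = y - x" by (simp add: v_def algebra_simps)
  then show ?thesis using t[OF x] by auto
qed

theorem positive_selfadjoint_resolvent:
  assumes T: "positive_selfadjoint T"
  shows "\<exists>B. resolvent B \<and> T = resolvent.T B"
proof -
  have sa: "selfadjoint_uop T" by (rule positive_selfadjointD(1)[OF T])
  note lin = selfadjoint_linear[OF sa]
  obtain f where f: "\<And>y. (f y, y - f y) \<in> T"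
    using resolvent_solves[OF T] by metis
  have "\<exists>B. effect B \<and> (\<forall>x. blinfun_apply B x = f x)"
  proof (rule effect_of_symmetric_firmly_nonexpansive)
    fix x y
    show "cinner (f x) y = cinner x (f y)"
      using selfadjoint_symmetric[OF sa f f, of x y] by (simp add: cinner.diff_left cinner.diff_right)
  next
    fix x
    have "0 \<le> Re (cinner (f x) (x - f x))"
      using positive_selfadjointD(2)[OF T f[of x]] by (simp add: complex_nonneg_Reals_iff)
    then show "(norm (f x))\<^sup>2 \<le> Re (cinner x (f x))"
      using inner_commute[of x "f x"]
      by (simp add: cinner.diff_right cinner_self_norm inner_ell2_def)
  qed
  then obtain B where B: "effect B" and Bf: "\<And>x. blinfun_apply B x = f x" by blast
  interpret resolvent B
  proof
    fix y assume "blinfun_apply B y = 0"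
    then have "(0, y) \<in> T" using f[of y] by (simp add: Bf)
    then show "y = 0"
      using single_valuedD[OF linear_uop_single_valued[OF lin] linear_uop_zero[OF lin]] by blast
  qed (rule B)
  have "resolvent.T B \<subseteq> T"
    using f by (auto simp: Bf elim!: T_cases)
  then have "resolvent.T B = T"
    by (rule selfadjoint_subset_eq[OF T_selfadjoint sa])
  then show ?thesis using resolvent_axioms by auto
qed

text \<open>As \<open>\<surd>T\<close> is its own adjoint and \<open>T = \<surd>T \<surd>T\<close>, membership in the graph of \<open>T\<close> is a statement about the
  form alone. This is how a form determines its operator.\<close>

lemma positive_selfadjoint_mem_iff_form:
  assumes T: "positive_selfadjoint T"
  shows "(x, z) \<in> T \<longleftrightarrow> x \<in> fdom (form_of_uop T) \<and>
    (\<forall>a\<in>fdom (form_of_uop T). fval (form_of_uop T) x a = cinner z a)"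
proof -
  obtain B where "resolvent B" and TB: "T = resolvent.T B"
    using positive_selfadjoint_resolvent[OF T] by blast
  interpret resolvent B by fact
  let ?S = "resolvent.S B"
  have S: "uop_sqrt (resolvent.T B) = ?S" by (rule sqrt_T)
  note sv = linear_uop_single_valued[OF selfadjoint_linear[OF S_selfadjoint]]
  have "(x, z) \<in> T \<longleftrightarrow> (\<exists>w. (x, w) \<in> ?S \<and> (w, z) \<in> ?S)"
    unfolding TB S_square[symmetric] by blast
  also have "\<dots> \<longleftrightarrow> (\<exists>w. (x, w) \<in> ?S \<and> (\<forall>a v. (a, v) \<in> ?S \<longrightarrow> cinner w v = cinner z a))"
    by (subst selfadjoint_mem_iff[OF S_selfadjoint, of _ z]) simp
  also have "\<dots> \<longleftrightarrow> x \<in> Domain ?S \<and>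
      (\<forall>a\<in>Domain ?S. cinner (uop_apply ?S x) (uop_apply ?S a) = cinner z a)"
    (is "?L \<longleftrightarrow> ?R")
  proof
    assume ?L
    then obtain w where w: "(x, w) \<in> ?S" "\<And>a v. (a, v) \<in> ?S \<Longrightarrow> cinner w v = cinner z a" by blast
    have "cinner (uop_apply ?S x) (uop_apply ?S a) = cinner z a" if "(a, v) \<in> ?S" for a v
      using w(2)[OF that] by (simp add: uop_apply_eq[OF sv w(1)] uop_apply_eq[OF sv that])
    then show ?R using w(1) by blast
  next
    assume ?R
    then obtain w where w: "(x, w) \<in> ?S" by blast
    have "cinner w v = cinner z a" if "(a, v) \<in> ?S" for a v
      using \<open>?R\<close> that by (auto simp: uop_apply_eq[OF sv w] uop_apply_eq[OF sv that] dest!: bspec[of _ _ a])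
    then show ?L using w by blast
  qed
  finally show ?thesis by (simp add: form_of_uop_def TB S)
qed

section \<open>Closed forms and their operators\<close>

lemma psd_formD:
  assumes "psd_form q"
  shows psd_csubspace: "csubspace (fdom q)"
    and psd_dense: "closure (fdom q) = UNIV"
    and psd_add_left: "x \<in> fdom q \<Longrightarrow> y \<in> fdom q \<Longrightarrow> z \<in> fdom q \<Longrightarrow> fval q (x + y) z = fval q x z + fval q y z"
    and psd_add_right: "x \<in> fdom q \<Longrightarrow> y \<in> fdom q \<Longrightarrow> z \<in> fdom q \<Longrightarrow> fval q x (y + z) = fval q x y + fval q x z"
    and psd_scale_left: "x \<in> fdom q \<Longrightarrow> y \<in> fdom q \<Longrightarrow> fval q (scaleC c x) y = cnj c * fval q x y"
    and psd_scale_right: "x \<in> fdom q \<Longrightarrow> y \<in> fdom q \<Longrightarrow> fval q x (scaleC c y) = c * fval q x y"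
    and psd_nonneg: "x \<in> fdom q \<Longrightarrow> fval q x x \<in> \<real>\<^sub>\<ge>\<^sub>0"
  using assms unfolding psd_form_def by blast+

text \<open>Polarisation: over the complex numbers a sesquilinear form that is real on the diagonal is
  Hermitian, as one sees on \<open>x + y\<close> and \<open>x + \<i> y\<close>.\<close>

lemma psd_hermitian:
  assumes q: "psd_form q" and x: "x \<in> fdom q" and y: "y \<in> fdom q"
  shows "fval q y x = cnj (fval q x y)"
proof -
  have mem: "x + y \<in> fdom q" "scaleC \<i> y \<in> fdom q" "x + scaleC \<i> y \<in> fdom q"
    using psd_csubspace[OF q] x y by (auto simp: csubspace_def)
  have real: "Im (fval q z z) = 0" if "z \<in> fdom q" for z
    using psd_nonneg[OF q that] by (simp add: complex_nonneg_Reals_iff)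
  have "Im (fval q x y) + Im (fval q y x) = 0"
    using real[OF mem(1)] real[OF x] real[OF y] x y mem
    by (simp add: psd_add_left[OF q] psd_add_right[OF q])
  moreover have "Re (fval q x y) - Re (fval q y x) = 0"
    using real[OF mem(3)] real[OF x] real[OF y] x y mem
    by (simp add: psd_add_left[OF q] psd_add_right[OF q] psd_scale_left[OF q] psd_scale_right[OF q])
  ultimately show ?thesis by (simp add: complex_eq_iff)
qed

definition form_inner :: "'a sform \<Rightarrow> 'a ell2 \<Rightarrow> 'a ell2 \<Rightarrow> complex" where
  "form_inner q x y = fval q x y + cinner x y"

lemma form_norm_eq: "form_norm q x = sqrt (Re (form_inner q x x))"
  by (simp add: form_norm_def form_inner_def cinner_self_norm)

lemma closed_form_iff_hilbert_form:
  "closed_form q \<longleftrightarrow> psd_form q \<and> hilbert_form (fdom q) (form_inner q)"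
proof (intro iffI conjI; (elim conjE)?)
  assume closed: "closed_form q"
  show q: "psd_form q" using closed by (simp add: closed_form_def)
  show "hilbert_form (fdom q) (form_inner q)"
  proof
    show "csubspace (fdom q)" by (rule psd_csubspace[OF q])
    show "form_inner q y x = cnj (form_inner q x y)" if "x \<in> fdom q" "y \<in> fdom q" for x y
      using psd_hermitian[OF q that] cinner_commute[of y x] by (simp add: form_inner_def)
    show "(norm x)\<^sup>2 \<le> Re (form_inner q x x)" if "x \<in> fdom q" for x
      using psd_nonneg[OF q that]
      by (simp add: form_inner_def cinner_self_norm complex_nonneg_Reals_iff)
    fix X :: "nat \<Rightarrow> 'a ell2"
    assume "\<And>n. X n \<in> fdom q"
      and "\<And>e. e > 0 \<Longrightarrow> \<exists>N. \<forall>m\<ge>N. \<forall>n\<ge>N. sqrt (Re (form_inner q (X m - X n) (X m - X n))) < e"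
    then show "\<exists>x\<in>fdom q. (\<lambda>n. sqrt (Re (form_inner q (X n - x) (X n - x)))) \<longlonglongrightarrow> 0"
      using closed unfolding closed_form_def form_norm_eq by simp
  qed (auto simp: form_inner_def psd_add_right[OF q] psd_scale_right[OF q] cinner_add_right
      cinner_scaleC_right algebra_simps)
next
  assume q: "psd_form q" and "hilbert_form (fdom q) (form_inner q)"
  then interpret P: hilbert_form "fdom q" "form_inner q" by simp
  show "closed_form q"
    unfolding closed_form_def form_norm_eq using q P.complete by simp
qed

lemma form_extends_trans: "form_extends r q \<Longrightarrow> form_extends s r \<Longrightarrow> form_extends s q"
  unfolding form_extends_def by (metis subsetD subset_trans)

text \<open>Values off the domain carry no meaning, so mutual extension takes the place of equality of forms.\<close>

lemma mutual_extension:
  assumes "form_extends r q" "form_extends q r"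
  shows "fdom r = fdom q" "x \<in> fdom q \<Longrightarrow> y \<in> fdom q \<Longrightarrow> fval r x y = fval q x y"
  using assms by (auto simp: form_extends_def)

lemma closed_form_mutual_extension:
  assumes q: "closed_form q" and ext: "form_extends r q" "form_extends q r"
  shows "closed_form r"
proof -
  note eq = mutual_extension[OF ext]
  have psd: "psd_form q" using q by (simp add: closed_form_def)
  note sub = psd_csubspace[OF psd]
  have mem: "x + y \<in> fdom q" "scaleC c x \<in> fdom q" "x - y \<in> fdom q"
    if "x \<in> fdom q" "y \<in> fdom q" for x y c
    using sub that csubspace_diff[OF sub] by (auto simp: csubspace_def)
  have norm_eq: "form_norm r x = form_norm q x" if "x \<in> fdom q" for x
    using that by (simp add: form_norm_def eq)
  have "psd_form r"
    unfolding psd_form_def eq(1)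
    using psd_formD[OF psd] by (simp add: eq mem)
  moreover have "\<exists>x\<in>fdom r. (\<lambda>n. form_norm r (X n - x)) \<longlonglongrightarrow> 0"
    if X: "\<And>n. X n \<in> fdom r" and C: "\<forall>e>0. \<exists>N. \<forall>m\<ge>N. \<forall>n\<ge>N. form_norm r (X m - X n) < e" for X
  proof -
    have "\<exists>x\<in>fdom q. (\<lambda>n. form_norm q (X n - x)) \<longlonglongrightarrow> 0"
      using q X C unfolding closed_form_def eq(1) by (simp add: norm_eq mem)
    then show ?thesis using X unfolding eq(1) by (auto simp: norm_eq mem)
  qed
  ultimately show ?thesis unfolding closed_form_def by blast
qed

subsection \<open>The representation theorem\<close>

text \<open>Let \<open>q\<^sub>1 = q + \<langle>\<cdot>, \<cdot>\<rangle>\<close>. The Riesz theorem in the Hilbert space \<open>(dom q, q\<^sub>1)\<close> yields \<open>B\<close> with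
  \<open>q\<^sub>1(B y, z) = \<langle>y, z\<rangle>\<close>; it will be \<open>(1 + T)\<inverse>\<close>. As \<open>q\<^sub>1(B y, B y) = \<parallel>\<surd>B y\<parallel>\<^sup>2\<close> and the range of \<open>B\<close> is dense
  in the \<open>q\<^sub>1\<close>-norm, every \<open>x\<close> in the domain is \<open>\<surd>B w\<close> with \<open>\<parallel>w\<parallel>\<^sup>2 = q\<^sub>1(x, x)\<close>. Conversely, for every
  \<open>w\<close> the functional \<open>z \<mapsto> \<langle>w, (\<surd>B)\<inverse> z\<rangle>\<close> is represented by \<open>\<surd>B w\<close>, so \<open>\<surd>B\<close> is a unitary map onto the
  form domain, and \<open>q(\<surd>B w, \<surd>B v) = \<langle>w, v\<rangle> - \<langle>\<surd>B w, \<surd>B v\<rangle> = \<langle>\<surd>(1-B) w, \<surd>(1-B) v\<rangle>\<close>.\<close>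

theorem closed_form_representation:
  assumes closed: "closed_form q"
  shows "\<exists>T. positive_selfadjoint T \<and> form_extends (form_of_uop T) q \<and> form_extends q (form_of_uop T)"
proof -
  let ?D = "fdom q" and ?p = "form_inner q"
  have psd: "psd_form q" using closed by (simp add: closed_form_def)
  interpret P: hilbert_form ?D ?p
    using closed by (simp add: closed_form_iff_hilbert_form)
  have "\<exists>x\<in>?D. \<forall>z\<in>?D. ?p x z = cinner y z" for y
  proof (rule P.riesz)
    fix z assume z: "z \<in> ?D"
    have "cmod (cinner y z) \<le> norm y * norm z" by (rule cmod_cinner_le)
    also have "\<dots> \<le> norm y * P.pn z" by (intro mult_left_mono P.norm_le_pn z) simp
    finally show "cmod (cinner y z) \<le> norm y * P.pn z" .
  qed (simp_all add: cinner_add_right cinner_scaleC_right)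
  then obtain f where fD: "\<And>y. f y \<in> ?D" and f: "\<And>y z. z \<in> ?D \<Longrightarrow> ?p (f y) z = cinner y z"
    by metis
  have "\<exists>B. effect B \<and> (\<forall>x. blinfun_apply B x = f x)"
  proof (rule effect_of_symmetric_firmly_nonexpansive)
    fix x y
    show "cinner (f x) y = cinner x (f y)"
      using P.hermitian[OF fD fD, of x y] cinner_commute[of "f x" y] by (simp add: f fD)
    show "(norm (f x))\<^sup>2 \<le> Re (cinner x (f x))"
      using P.coercive[OF fD, of x] by (simp add: f fD)
  qed
  then obtain B where B: "effect B" and Bf: "\<And>x. blinfun_apply B x = f x" by blast
  interpret R: resolvent B
  proof
    fix y assume y: "blinfun_apply B y = 0"
    have "?p 0 z = 0" if "z \<in> ?D" for z
      using P.scaleR_left[OF P.zero_mem that, of 0] by simp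
    then have "?D \<subseteq> {z. cinner y z = 0}"
      using f[of _ y] y by (auto simp: Bf)
    moreover have "closed {z. cinner y z = 0}"
      by (intro closed_Collect_eq cinner.continuous_on continuous_intros)
    ultimately have "closure ?D \<subseteq> {z. cinner y z = 0}" by (rule closure_minimal)
    then have "cinner y y = 0" unfolding psd_dense[OF psd] by blast
    then show "y = 0" by (simp add: cinner_self_norm)
  qed (rule B)
  have bD: "R.b y \<in> ?D" and pb: "z \<in> ?D \<Longrightarrow> ?p (R.b y) z = cinner y z" for y z
    by (simp_all add: Bf fD f)
  have hc: "hermitian_op R.C" by (rule effect_hermitian[OF R.effect_C])
  have pn_b: "P.pn (R.b y) = norm (R.c y)" for y
  proof -
    have "?p (R.b y) (R.b y) = cinner (R.c y) (R.c y)"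
      using pb[OF bD] by (simp add: R.cc[symmetric] hermitianD[OF hc])
    then show ?thesis by (simp add: P.pn_def cinner_self_norm)
  qed
  have dense: "P.pclosure (range R.b) = ?D"
  proof (rule P.dense_if_no_orthogonal)
    show "csubspace (range R.b)" by (rule csubspace_range[OF effect_hermitian[OF B]])
    show "range R.b \<subseteq> ?D" using bD by auto
    fix x assume x: "x \<in> ?D" and orth: "\<And>z. z \<in> range R.b \<Longrightarrow> ?p x z = 0"
    have "cinner x x = 0"
      using pb[OF x, of x] P.hermitian[OF x bD, of x] orth[of "R.b x"] by simp
    then show "x = 0" by (simp add: cinner_self_norm)
  qed
  have in_range: "\<exists>w. x = R.c w \<and> norm w = P.pn x" if x: "x \<in> ?D" for x
  proof -
    have "x \<in> P.pclosure (range R.b)" using x dense by simp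
    then obtain X where "\<And>n. X n \<in> range R.b" and lim: "P.plim X x"
      unfolding P.pclosure_def by blast
    then have "\<forall>n. \<exists>y. X n = R.b y" by (simp add: image_iff)
    then obtain y where X: "\<And>n. X n = R.b (y n)" by metis
    have XD: "X n \<in> ?D" for n by (simp add: X bD)
    have "Cauchy (\<lambda>n. R.c (y n))"
      using P.plim_pcauchy[OF XD x lim]
      unfolding Cauchy_iff P.pcauchy_def X blinfun.diff_right[symmetric] pn_b .
    then obtain w where w: "(\<lambda>n. R.c (y n)) \<longlonglongrightarrow> w"
      using Cauchy_convergent[of "\<lambda>n. R.c (y n)"] by (auto simp: convergent_def)
    have "(\<lambda>n. R.c (R.c (y n))) \<longlonglongrightarrow> R.c w"
      by (intro blinfun.tendsto tendsto_const w)
    moreover have "X \<longlonglongrightarrow> x" by (rule P.plim_norm[OF XD x lim])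
    ultimately have xw: "x = R.c w"
      using LIMSEQ_unique[of X] by (simp add: R.cc X[symmetric])
    have "(\<lambda>n. sqrt (Re (?p (X n) (X n)))) \<longlonglongrightarrow> sqrt (Re (?p x x))"
      by (intro tendsto_intros P.tendsto_p[OF XD x lim XD x lim])
    moreover have "(\<lambda>n. norm (R.c (y n))) \<longlonglongrightarrow> norm w"
      by (intro tendsto_norm w)
    ultimately have "norm w = P.pn x"
      using LIMSEQ_unique[of "\<lambda>n. norm (R.c (y n))"]
      by (simp add: P.pn_def[symmetric] X pn_b)
    with xw show ?thesis by blast
  qed
  define g where "g = inv R.c"
  have "inj R.c"
  proof (rule injI)
    fix u v assume "R.c u = R.c v"
    then have "R.c (u - v) = 0" by (simp add: blinfun.diff_right)
    then show "u = v" using R.c_injective by fastforce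
  qed
  then have g: "g (R.c v) = v" for v by (simp add: g_def)
  have unitary: "R.c w \<in> ?D \<and> (\<forall>z\<in>?D. ?p (R.c w) z = cinner w (g z))" for w
  proof -
    have "\<exists>x\<in>?D. \<forall>z\<in>?D. ?p x z = cinner w (g z)"
    proof (rule P.riesz)
      fix y z assume "y \<in> ?D" "z \<in> ?D"
      then obtain u v where "y = R.c u" "z = R.c v" using in_range by blast
      then show "cinner w (g (y + z)) = cinner w (g y) + cinner w (g z)"
        using g[of "u + v"] by (simp add: g blinfun.add_right cinner_add_right)
    next
      fix a z assume "z \<in> ?D"
      then obtain v where "z = R.c v" using in_range by blast
      then show "cinner w (g (scaleC a z)) = a * cinner w (g z)"
        using g[of "scaleC a v"] by (simp add: g hermitian_scaleC[OF hc] cinner_scaleC_right)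
    next
      fix z assume "z \<in> ?D"
      then obtain v where "z = R.c v" "norm v = P.pn z" using in_range by blast
      then show "cmod (cinner w (g z)) \<le> norm w * P.pn z"
        using cmod_cinner_le[of w v] by (simp add: g)
    qed
    then obtain x where x: "x \<in> ?D" "\<And>z. z \<in> ?D \<Longrightarrow> ?p x z = cinner w (g z)" by blast
    have "cinner y x = cinner y (R.c w)" for y
    proof -
      have "cinner y x = cnj (?p x (R.b y))"
        using pb[OF x(1), of y] P.hermitian[OF x(1) bD, of y] by simp
      also have "\<dots> = cnj (cinner w (R.c y))"
        using x(2)[OF bD, of y] g[of "R.c y"] by (simp add: R.cc)
      also have "\<dots> = cinner y (R.c w)"
        using cinner_commute[of "R.c y" w] by (simp add: hermitianD[OF hc])
      finally show ?thesis .
    qed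
    then have "x = R.c w" by (rule cinner_ext_right)
    then show ?thesis using x by blast
  qed
  have D_eq: "?D = range R.c"
    using in_range unitary by blast
  have q_eq: "fval q (R.c w) (R.c v) = cinner (R.d w) (R.d v)" for w v
  proof -
    have "fval q (R.c w) (R.c v) + cinner (R.c w) (R.c v) = cinner w v"
      using unitary[of w] unitary[of v] g[of v] by (auto simp: form_inner_def)
    moreover have "cinner (R.c w) (R.c v) = cinner w (R.b v)"
      by (simp add: hermitianD[OF hc] R.cc)
    moreover have "cinner (R.d w) (R.d v) = cinner w v - cinner w (R.b v)"
      by (simp add: effectD[OF R.effect_D] R.dd cinner.diff_right)
    ultimately show ?thesis by (metis add_diff_cancel_right')
  qed
  have dom: "fdom (form_of_uop R.T) = ?D"
    unfolding form_of_uop_def R.sqrt_T D_eq by (auto simp: R.S_def pair_graph_def)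
  have app: "uop_apply R.S (R.c w) = R.d w" for w
    by (rule uop_apply_eq[OF linear_uop_single_valued[OF selfadjoint_linear[OF R.S_selfadjoint]]])
      (simp add: R.S_def pair_graph_mem)
  have val: "fval (form_of_uop R.T) x y = fval q x y" if "x \<in> ?D" "y \<in> ?D" for x y
    using that unfolding form_of_uop_def R.sqrt_T D_eq by (auto simp: app q_eq)
  have "form_extends (form_of_uop R.T) q \<and> form_extends q (form_of_uop R.T)"
    unfolding form_extends_def dom using val by simp
  then show ?thesis using R.T_positive by blast
qed

subsection \<open>Closures of forms\<close>

lemma closed_form_pclosure:
  assumes r: "closed_form r" and ext: "form_extends r q" and q: "psd_form q"
  shows "closed_form (Form (hilbert_form.pclosure (fdom r) (form_inner r) (fdom q)) (fval r))"
    and "form_extends (Form (hilbert_form.pclosure (fdom r) (form_inner r) (fdom q)) (fval r)) q"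
proof -
  interpret P: hilbert_form "fdom r" "form_inner r"
    using r by (simp add: closed_form_iff_hilbert_form)
  have psd_r: "psd_form r" using r by (simp add: closed_form_def)
  let ?E = "P.pclosure (fdom q)" and ?s = "Form (P.pclosure (fdom q)) (fval r)"
  have sub: "fdom q \<subseteq> fdom r" using ext by (simp add: form_extends_def)
  have E_sub: "x \<in> ?E \<Longrightarrow> x \<in> fdom r" for x by (simp add: P.pclosure_def)
  have E: "hilbert_form ?E (form_inner r)"
    by (rule P.hilbert_form_pclosure[OF psd_csubspace[OF q] sub])
  have q_sub: "fdom q \<subseteq> ?E" by (rule P.pclosure_subset[OF sub])
  have "closure ?E = UNIV"
    using closure_mono[OF q_sub] psd_dense[OF q] by blast
  moreover have "csubspace ?E" by (rule hilbert_form.subspace[OF E])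
  ultimately have "psd_form ?s"
    using psd_formD[OF psd_r] unfolding psd_form_def by (auto dest!: E_sub)
  moreover have "form_inner ?s = form_inner r"
    by (simp add: fun_eq_iff form_inner_def)
  ultimately show "closed_form ?s"
    using E by (simp add: closed_form_iff_hilbert_form)
  show "form_extends ?s q"
    using ext q_sub by (simp add: form_extends_def)
qed

text \<open>The closure is cut out of any closed extension: it consists of the limits, in the form norm of that
  extension, of sequences in the original domain. Such sequences are Cauchy with respect to every other
  closed extension too, and the form norms dominate the Hilbert space norm, so their limits agree.\<close>

theorem form_closure_exists:
  assumes "closable_form q"
  shows "\<exists>r. is_form_closure q r"
proof -
  obtain r where r: "closed_form r" and ext: "form_extends r q" and q: "psd_form q"
    using assms by (auto simp: closable_form_def)
  interpret P: hilbert_form "fdom r" "form_inner r"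
    using r by (simp add: closed_form_iff_hilbert_form)
  let ?E = "P.pclosure (fdom q)"
  have sub: "fdom q \<subseteq> fdom r" using ext by (simp add: form_extends_def)
  have "form_extends r' (Form ?E (fval r))" if r': "closed_form r'" and ext': "form_extends r' q" for r'
  proof -
    interpret P': hilbert_form "fdom r'" "form_inner r'"
      using r' by (simp add: closed_form_iff_hilbert_form)
    have sub': "fdom q \<subseteq> fdom r'" using ext' by (simp add: form_extends_def)
    have agree: "form_inner r' x y = form_inner r x y" if "x \<in> fdom q" "y \<in> fdom q" for x y
      using that ext ext' by (simp add: form_extends_def form_inner_def)
    have diff: "x - y \<in> fdom q" if "x \<in> fdom q" "y \<in> fdom q" for x y
      using csubspace_diff[OF psd_csubspace[OF q] that] .
    have transfer: "x \<in> fdom r' \<and> P'.plim X x"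
      if X: "\<And>n. X n \<in> fdom q" and x: "x \<in> fdom r" and lim: "P.plim X x" for X x
    proof -
      have XD: "X n \<in> fdom r" "X n \<in> fdom r'" for n using X sub sub' by auto
      have "P'.pcauchy X"
        using P.plim_pcauchy[OF XD(1) x lim]
        by (simp add: P.pcauchy_def P'.pcauchy_def P.pn_def P'.pn_def agree X diff)
      then obtain x' where x': "x' \<in> fdom r'" and lim': "P'.plim X x'"
        using P'.pcauchy_plim[of X] XD(2) by blast
      have "x' = x"
        using LIMSEQ_unique[OF P'.plim_norm[OF XD(2) x' lim'] P.plim_norm[OF XD(1) x lim]] .
      then show ?thesis using x' lim' by simp
    qed
    have "fval r' x y = fval r x y" if xE: "x \<in> ?E" and yE: "y \<in> ?E" for x y
    proof -
      obtain X where X: "\<And>n. X n \<in> fdom q" and x: "x \<in> fdom r" and limX: "P.plim X x"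
        using xE by (auto simp: P.pclosure_def)
      obtain Y where Y: "\<And>n. Y n \<in> fdom q" and y: "y \<in> fdom r" and limY: "P.plim Y y"
        using yE by (auto simp: P.pclosure_def)
      note x' = transfer[OF X x limX] and y' = transfer[OF Y y limY]
      have "(\<lambda>n. form_inner r (X n) (Y n)) \<longlonglongrightarrow> form_inner r x y"
        using X Y sub by (intro P.tendsto_p x y limX limY) auto
      moreover have "(\<lambda>n. form_inner r' (X n) (Y n)) \<longlonglongrightarrow> form_inner r' x y"
        using X Y sub' x' y' by (intro P'.tendsto_p) auto
      ultimately have "form_inner r' x y = form_inner r x y"
        using LIMSEQ_unique by (simp add: agree X Y)
      then show ?thesis by (simp add: form_inner_def)
    qed
    moreover have "?E \<subseteq> fdom r'"
      using transfer by (auto simp: P.pclosure_def)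
    ultimately show ?thesis by (simp add: form_extends_def)
  qed
  then have "is_form_closure q (Form ?E (fval r))"
    using closed_form_pclosure[OF r ext q] by (simp add: is_form_closure_def)
  then show ?thesis by blast
qed

text \<open>The limits of form-Cauchy sequences from the original domain already carry a closed extension inside
  \<open>r\<close>, and minimality of \<open>r\<close> leaves room for nothing else.\<close>

lemma form_closure_approx:
  assumes closure: "is_form_closure q r" and q: "psd_form q" and x: "x \<in> fdom r"
  shows "\<exists>X. (\<forall>n. X n \<in> fdom q) \<and> hilbert_form.plim (form_inner r) X x"
proof -
  have r: "closed_form r" and ext: "form_extends r q" using closure by (auto simp: is_form_closure_def)
  interpret P: hilbert_form "fdom r" "form_inner r"
    using r by (simp add: closed_form_iff_hilbert_form)
  have "form_extends (Form (P.pclosure (fdom q)) (fval r)) r"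
    using closure closed_form_pclosure[OF r ext q] by (simp add: is_form_closure_def)
  then have "x \<in> P.pclosure (fdom q)" using x by (auto simp: form_extends_def)
  then show ?thesis by (simp add: P.pclosure_def)
qed

lemma form_closure_mutual_extension:
  assumes r: "is_form_closure q r" and ext: "form_extends s r" "form_extends r s"
  shows "is_form_closure q s"
  using r closed_form_mutual_extension[OF _ ext] form_extends_trans[OF _ ext(1)]
    form_extends_trans[OF ext(2)]
  unfolding is_form_closure_def by blast

text \<open>Closures of the same form extend each other, and a positive self-adjoint operator is determined by
  its form.\<close>

lemma form_closure_operator_unique:
  assumes T: "positive_selfadjoint T" "is_form_closure q (form_of_uop T)"
    and T': "positive_selfadjoint T'" "is_form_closure q (form_of_uop T')"
  shows "T' = T"
proof -
  have "form_extends (form_of_uop T) (form_of_uop T')" "form_extends (form_of_uop T') (form_of_uop T)"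
    using T(2) T'(2) unfolding is_form_closure_def by blast+
  note eq = mutual_extension[OF this]
  have "(x, z) \<in> T' \<longleftrightarrow> (x, z) \<in> T" for x z
    unfolding positive_selfadjoint_mem_iff_form[OF T(1)] positive_selfadjoint_mem_iff_form[OF T'(1)]
    using eq by auto
  then show ?thesis by auto
qed

text \<open>The form norm of \<open>T\<close> is the graph norm of \<open>\<surd>T\<close>, so approximation in the form norm is approximation
  in the graph.\<close>

lemma form_closure_core:
  assumes T: "positive_selfadjoint T" and closure: "is_form_closure q (form_of_uop T)"
    and q: "psd_form q"
  shows "is_core (fdom q) (uop_sqrt T)"
proof -
  obtain B where "resolvent B" and TB: "T = resolvent.T B"
    using positive_selfadjoint_resolvent[OF T] by blast
  interpret R: resolvent B by fact
  let ?t = "form_of_uop T"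
  have S: "uop_sqrt T = R.S" unfolding TB by (rule R.sqrt_T)
  note lin = selfadjoint_linear[OF R.S_selfadjoint]
  note app = uop_apply_eq[OF linear_uop_single_valued[OF lin]]
  have dom: "fdom ?t = Domain R.S" by (simp add: form_of_uop_def S)
  have sub: "fdom q \<subseteq> Domain R.S"
    using closure by (simp add: is_form_closure_def form_extends_def dom)
  interpret P: hilbert_form "fdom ?t" "form_inner ?t"
    using closure by (simp add: is_form_closure_def closed_form_iff_hilbert_form)
  have "(x, y) \<in> closure {(x, y) \<in> R.S. x \<in> fdom q}" if xy: "(x, y) \<in> R.S" for x y
  proof -
    have x: "x \<in> fdom ?t" using xy by (auto simp: dom)
    obtain X where X: "\<And>n. X n \<in> fdom q" and lim: "P.plim X x"
      using form_closure_approx[OF closure q x] by blast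
    define Y where "Y n = uop_apply R.S (X n)" for n
    have XY: "(X n, Y n) \<in> R.S" for n
      using X[of n] sub app by (auto simp: Y_def)
    have XD: "X n \<in> fdom ?t" for n using XY[of n] by (auto simp: dom)
    have "norm (Y n - y) \<le> P.pn (X n - x)" for n
    proof -
      have "uop_apply R.S (X n - x) = Y n - y"
        by (rule app) (rule linear_uop_diff[OF lin XY xy])
      then have "form_inner ?t (X n - x) (X n - x) = of_real ((norm (Y n - y))\<^sup>2 + (norm (X n - x))\<^sup>2)"
        by (simp add: form_inner_def form_of_uop_def S cinner_self_norm)
      then have "(P.pn (X n - x))\<^sup>2 = (norm (Y n - y))\<^sup>2 + (norm (X n - x))\<^sup>2"
        using P.pn_square[OF P.diff_mem[OF XD x], of n] by simp
      then have "(norm (Y n - y))\<^sup>2 \<le> (P.pn (X n - x))\<^sup>2" by simp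
      then show ?thesis
        by (rule power2_le_imp_le) (rule P.pn_nonneg[OF P.diff_mem[OF XD x]])
    qed
    then have "(\<lambda>n. Y n - y) \<longlonglongrightarrow> 0"
      by (intro Lim_null_comparison[OF always_eventually lim[unfolded P.plim_def]] allI)
    then have "Y \<longlonglongrightarrow> y" by (rule LIM_zero_cancel)
    then have "(\<lambda>n. (X n, Y n)) \<longlonglongrightarrow> (x, y)"
      by (intro tendsto_Pair P.plim_norm[OF XD x lim])
    moreover have "(X n, Y n) \<in> {(x, y) \<in> R.S. x \<in> fdom q}" for n using XY X by simp
    ultimately show ?thesis
      unfolding closure_sequential by (intro exI[of _ "\<lambda>n. (X n, Y n)"] conjI allI)
  qed
  then show ?thesis using sub by (auto simp: is_core_def S)
qed

section \<open>The free disk algebra\<close>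

lemma Lshift_apply: "blinfun_apply (Lshift k) x = shift_fun k x"
  by (simp add: Lshift.rep_eq)

lemma scaleC_op_apply: "blinfun_apply (scaleC_op c) x = scaleC c x"
  by (simp add: scaleC_op.rep_eq)

lemma Lshift_scaleC: "blinfun_apply (Lshift k) (scaleC c x) = scaleC c (blinfun_apply (Lshift k) x)"
  unfolding Lshift_apply by transfer (auto split: list.splits)

lemma cinner_Lshift:
  "cinner (blinfun_apply (Lshift j) x) (blinfun_apply (Lshift k) y) = (if j = k then cinner x y else 0)"
proof -
  let ?f = "\<lambda>w. cnj (Rep_ell2 (shift_fun j x) w) * Rep_ell2 (shift_fun k y) w"
  show ?thesis
  proof (cases "j = k")
    case True
    have "infsum ?f UNIV = infsum ?f (range (Cons k))"
      by (rule infsum_cong_neutral) (auto simp: shift_fun.rep_eq split: list.splits)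
    also have "\<dots> = (\<Sum>\<^sub>\<infinity>w. cnj (Rep_ell2 x w) * Rep_ell2 y w)"
      by (subst infsum_reindex) (auto simp: o_def shift_fun.rep_eq True)
    finally show ?thesis by (simp add: Lshift_apply cinner.rep_eq True)
  next
    case False
    then have "?f w = 0" for w by (auto simp: shift_fun.rep_eq split: list.splits)
    then have "infsum ?f UNIV = 0" by (intro infsum_0)
    then show ?thesis using False by (simp add: Lshift_apply cinner.rep_eq)
  qed
qed

lemma free_polys_subset_disk_algebra: "free_polys \<subseteq> disk_algebra"
  unfolding disk_algebra_def by (rule closure_subset)

lemma disk_algebra_Lshift_compose:
  assumes "A \<in> disk_algebra"
  shows "Lshift k o\<^sub>L A \<in> disk_algebra"
proof -
  have "(\<lambda>A. Lshift k o\<^sub>L A) ` closure free_polys \<subseteq> closure free_polys"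
    by (rule image_closure_subset)
      (auto intro!: continuous_intros closure_subset[THEN subsetD] free_polys.intros
        bounded_linear.continuous_on[OF bounded_bilinear.bounded_linear_right[OF bounded_bilinear_blinfun_compose]])
  then show ?thesis using assms by (auto simp: disk_algebra_def)
qed

text \<open>The commutant of any operator is closed, so it contains the disk algebra as soon as it contains
  the generators.\<close>

lemma disk_algebra_commute:
  fixes F :: "'d::finite list bop"
  assumes shift: "\<And>k. Lshift k o\<^sub>L F = F o\<^sub>L Lshift k"
    and scale: "\<And>c. scaleC_op c o\<^sub>L F = F o\<^sub>L scaleC_op c"
    and A: "A \<in> disk_algebra"
  shows "A o\<^sub>L F = F o\<^sub>L A"
proof -
  have shift': "blinfun_apply (Lshift k) (blinfun_apply F x) = blinfun_apply F (blinfun_apply (Lshift k) x)" for k x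
    using arg_cong[OF shift, of "\<lambda>G. blinfun_apply G x"] by simp
  have scale': "scaleC c (blinfun_apply F x) = blinfun_apply F (scaleC c x)" for c x
    using arg_cong[OF scale, of "\<lambda>G. blinfun_apply G x"] by (simp add: scaleC_op_apply)
  have "blinfun_apply P (blinfun_apply F x) = blinfun_apply F (blinfun_apply P x)"
    if "P \<in> free_polys" for P x
    using that
    by (induction arbitrary: x)
      (simp_all add: shift' scale' scaleC_op_apply blinfun.add_left blinfun.add_right)
  then have "P o\<^sub>L F = F o\<^sub>L P" if "P \<in> free_polys" for P
    using that by (intro blinfun_eqI) simp
  then have "free_polys \<subseteq> {A. A o\<^sub>L F = F o\<^sub>L A}" by blast
  moreover have "closed {A. A o\<^sub>L F = F o\<^sub>L A}"
    by (intro closed_Collect_eq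
        bounded_linear.continuous_on[OF bounded_bilinear.bounded_linear_left[OF bounded_bilinear_blinfun_compose]]
        bounded_linear.continuous_on[OF bounded_bilinear.bounded_linear_right[OF bounded_bilinear_blinfun_compose]]
        continuous_on_id)
  ultimately have "closure free_polys \<subseteq> {A. A o\<^sub>L F = F o\<^sub>L A}"
    by (rule closure_minimal)
  then show ?thesis using A by (auto simp: disk_algebra_def)
qed

lemma disk_algebra_scaleC:
  assumes "A \<in> disk_algebra"
  shows "blinfun_apply A (scaleC c x) = scaleC c (blinfun_apply A x)"
proof -
  have "A o\<^sub>L scaleC_op c = scaleC_op c o\<^sub>L A"
    by (rule disk_algebra_commute[OF _ _ assms])
      (auto intro!: blinfun_eqI simp: scaleC_op_apply Lshift_scaleC mult.commute)
  from arg_cong[OF this, of "\<lambda>F. blinfun_apply F x"] show ?thesis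
    by (simp add: scaleC_op_apply)
qed

subsection \<open>Right shifts and the injectivity of \<open>a \<mapsto> a 1\<close>\<close>

text \<open>This is right concatenation \<open>e\<^sub>u \<mapsto> e\<^bsub>uw\<^esub>\<close>.\<close>

lift_definition rshift_fun :: "'d list \<Rightarrow> 'd list ell2 \<Rightarrow> 'd list ell2"
  is "\<lambda>w f v. if v \<in> range (\<lambda>u. u @ w) then f (inv (\<lambda>u. u @ w) v) else 0"
proof -
  fix w :: "'d list" and f :: "'d list \<Rightarrow> complex"
  have inj: "inj (\<lambda>u. u @ w)" by (simp add: inj_def)
  let ?g = "\<lambda>v. if v \<in> range (\<lambda>u. u @ w) then f (inv (\<lambda>u. u @ w) v) else 0"
  assume "(\<lambda>i. (cmod (f i))\<^sup>2) summable_on UNIV"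
  then have "(\<lambda>v. (cmod (?g v))\<^sup>2) summable_on range (\<lambda>u. u @ w)"
    by (subst summable_on_reindex[OF inj]) (simp add: o_def inv_f_f[OF inj])
  then show "(\<lambda>v. (cmod (?g v))\<^sup>2) summable_on UNIV"
    by (subst summable_on_cong_neutral[where T = "range (\<lambda>u. u @ w)"]) auto
qed

lemma Rep_rshift_fun_append [simp]: "Rep_ell2 (rshift_fun w x) (u @ w) = Rep_ell2 x u"
proof -
  have "inj (\<lambda>u. u @ w)" by (simp add: inj_def)
  from inv_f_f[OF this, of u] show ?thesis by (simp add: rshift_fun.rep_eq)
qed

lemma Rep_rshift_fun_outside:
  "(\<And>u. v \<noteq> u @ w) \<Longrightarrow> Rep_ell2 (rshift_fun w x) v = 0"
  by (auto simp: rshift_fun.rep_eq)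

lemma norm_rshift_fun: "norm (rshift_fun w x) = norm x"
proof -
  let ?g = "\<lambda>v. (cmod (Rep_ell2 (rshift_fun w x) v))\<^sup>2"
  have inj: "inj (\<lambda>u. u @ w)" by (simp add: inj_def)
  have "infsum ?g UNIV = infsum ?g (range (\<lambda>u. u @ w))"
    by (rule infsum_cong_neutral) (auto simp: image_iff Rep_rshift_fun_outside)
  also have "\<dots> = (\<Sum>\<^sub>\<infinity>u. (cmod (Rep_ell2 x u))\<^sup>2)"
    by (subst infsum_reindex[OF inj]) (simp add: o_def)
  finally show ?thesis by (simp add: norm_ell2_def)
qed

lift_definition Rshift :: "'d list \<Rightarrow> 'd list bop" is rshift_fun
proof (rule bounded_linear_intro[where K = 1])
  fix w :: "'d list" and x y :: "'d list ell2" and r :: real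
  show "rshift_fun w (x + y) = rshift_fun w x + rshift_fun w y" by transfer auto
  show "rshift_fun w (r *\<^sub>R x) = r *\<^sub>R rshift_fun w x" by transfer auto
  show "norm (rshift_fun w x) \<le> norm x * 1" by (simp add: norm_rshift_fun)
qed

lemma Rshift_vac: "blinfun_apply (Rshift w) vac = ell2_basis w"
proof -
  have "Rep_ell2 (rshift_fun w (ell2_basis [])) v = Rep_ell2 (ell2_basis w) v" for v
  proof (cases "\<exists>u. v = u @ w")
    case True
    then show ?thesis
      using Rep_rshift_fun_append[of w "ell2_basis []" "[]"] by (auto simp: ell2_basis.rep_eq)
  next
    case False
    then have "v \<noteq> w" by (metis append_Nil)
    then show ?thesis using False by (simp add: Rep_rshift_fun_outside ell2_basis.rep_eq)
  qed
  then show ?thesis by (simp add: vac_def Rshift.rep_eq Rep_ell2_inject[symmetric] fun_eq_iff)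
qed

lemma Rshift_Lshift: "Lshift k o\<^sub>L Rshift w = Rshift w o\<^sub>L Lshift k"
proof (rule blinfun_eqI)
  fix x
  have "Rep_ell2 (shift_fun k (rshift_fun w x)) v = Rep_ell2 (rshift_fun w (shift_fun k x)) v" for v
  proof (cases "\<exists>u. v = u @ w")
    case True
    then obtain u where v: "v = u @ w" by blast
    show ?thesis
    proof (cases u)
      case Nil
      have "j # s = w \<Longrightarrow> s \<noteq> t @ w" for j s t
        using arg_cong[of s "t @ w" length] by auto
      then have "Rep_ell2 (shift_fun k (rshift_fun w x)) w = 0"
        by (auto simp: shift_fun.rep_eq Rep_rshift_fun_outside split: list.splits)
      moreover have "Rep_ell2 (rshift_fun w (shift_fun k x)) w = 0"
        using Rep_rshift_fun_append[of w "shift_fun k x" "[]"] by (simp add: shift_fun.rep_eq)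
      ultimately show ?thesis using Nil v by simp
    next
      case (Cons j s)
      then show ?thesis by (simp add: v shift_fun.rep_eq del: append_Cons) (simp add: shift_fun.rep_eq)
    qed
  next
    case False
    then have "j # s = v \<Longrightarrow> s \<noteq> t @ w" for j s t by (metis append_Cons)
    then show ?thesis
      using False by (auto simp: shift_fun.rep_eq Rep_rshift_fun_outside split: list.splits)
  qed
  then show "blinfun_apply (Lshift k o\<^sub>L Rshift w) x = blinfun_apply (Rshift w o\<^sub>L Lshift k) x"
    by (simp add: Lshift_apply Rshift.rep_eq Rep_ell2_inject[symmetric] fun_eq_iff)
qed

text \<open>Members of the disk algebra commute with the right shifts, so \<open>a 1\<close> determines
  \<open>a e\<^sub>w = a R\<^sub>w 1 = R\<^sub>w a 1\<close> for every word \<open>w\<close>. By duality the vectors \<open>a e\<^sub>w\<close> determine the vectors \<open>a\<^sup>* e\<^sub>v\<close>,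
  and these determine \<open>a\<close>.\<close>

lemma disk_algebra_inj: "inj_on (\<lambda>A. blinfun_apply A vac) (disk_algebra :: 'd::finite list bop set)"
proof (rule inj_onI)
  fix A B :: "'d list bop"
  assume A: "A \<in> disk_algebra" and B: "B \<in> disk_algebra"
    and eq: "blinfun_apply A vac = blinfun_apply B vac"
  have basis: "blinfun_apply F (ell2_basis w) = blinfun_apply (Rshift w) (blinfun_apply F vac)"
    if F: "F \<in> disk_algebra" for F :: "'d list bop" and w
  proof -
    have "F o\<^sub>L Rshift w = Rshift w o\<^sub>L F"
    proof (rule disk_algebra_commute[OF Rshift_Lshift _ F])
      show "scaleC_op c o\<^sub>L Rshift w = Rshift w o\<^sub>L scaleC_op c" for c
        by (rule blinfun_eqI) (simp add: scaleC_op_apply Rshift.rep_eq, transfer, auto)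
    qed
    from arg_cong[OF this, of "\<lambda>G. blinfun_apply G vac"] show ?thesis by (simp add: Rshift_vac)
  qed
  have "blinfun_apply (adj A) (ell2_basis v) = blinfun_apply (adj B) (ell2_basis v)" for v
  proof -
    have "cinner (ell2_basis w) (blinfun_apply (adj A) (ell2_basis v)) =
        cinner (ell2_basis w) (blinfun_apply (adj B) (ell2_basis v))" for w
      using cinner_adj[OF disk_algebra_scaleC[OF A], of "ell2_basis v" "ell2_basis w"]
        cinner_adj[OF disk_algebra_scaleC[OF B], of "ell2_basis v" "ell2_basis w"]
      by (metis basis[OF A] basis[OF B] eq cinner_commute)
    then show ?thesis by (simp add: cinner_basis Rep_ell2_inject[symmetric] fun_eq_iff)
  qed
  then have "cinner (ell2_basis v) (blinfun_apply A x) = cinner (ell2_basis v) (blinfun_apply B x)" for v x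
    using cinner_adj[OF disk_algebra_scaleC[OF A]] cinner_adj[OF disk_algebra_scaleC[OF B]] by metis
  then have "blinfun_apply A x = blinfun_apply B x" for x
    by (simp add: cinner_basis Rep_ell2_inject[symmetric] fun_eq_iff)
  then show "A = B" by (rule blinfun_eqI)
qed

lemma disk_op_mem: "x \<in> disk_vecs \<Longrightarrow> disk_op x \<in> disk_algebra"
  unfolding disk_vecs_def disk_op_def by (rule inv_into_into)

lemma disk_op_vac: "x \<in> disk_vecs \<Longrightarrow> blinfun_apply (disk_op x) vac = x"
  unfolding disk_vecs_def disk_op_def by (rule f_inv_into_f)

lemma disk_vecs_Lshift:
  assumes "x \<in> disk_vecs"
  shows "blinfun_apply (Lshift k) x \<in> disk_vecs"
    and "disk_op (blinfun_apply (Lshift k) x) = Lshift k o\<^sub>L disk_op x"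
proof -
  have mem: "Lshift k o\<^sub>L disk_op x \<in> disk_algebra"
    by (rule disk_algebra_Lshift_compose[OF disk_op_mem[OF assms]])
  have vac: "blinfun_apply (Lshift k o\<^sub>L disk_op x) vac = blinfun_apply (Lshift k) x"
    by (simp add: disk_op_vac[OF assms])
  show "blinfun_apply (Lshift k) x \<in> disk_vecs"
    unfolding disk_vecs_def using mem vac by (metis image_eqI)
  show "disk_op (blinfun_apply (Lshift k) x) = Lshift k o\<^sub>L disk_op x"
    using inv_into_f_f[OF disk_algebra_inj mem] by (simp add: disk_op_def disk_op_vac[OF assms, unfolded disk_op_def])
qed

section \<open>Toeplitz forms\<close>

text \<open>The relation \<open>L\<^sub>j\<^sup>* L\<^sub>k = \<delta>\<^sub>j\<^sub>k\<close> holds inside the product \<open>(L\<^sub>j a)\<^sup>* (L\<^sub>k b)\<close>, so the form only sees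
  \<open>\<delta>\<^sub>j\<^sub>k a\<^sup>* b\<close>.\<close>

lemma L_Toeplitz_nc_form:
  fixes \<mu> :: "'d::finite list bop \<Rightarrow> complex"
  assumes \<mu>: "positive_nc_measure \<mu>" and psd: "psd_form (nc_form \<mu>)"
  shows "L_Toeplitz_form (nc_form \<mu>)"
proof -
  have zero: "\<mu> 0 = 0"
  proof -
    have "(id_blinfun :: 'd list bop) \<in> disk_algebra"
      using free_polys.one free_polys_subset_disk_algebra by blast
    then have "id_blinfun + adj id_blinfun \<in> {A + adj B | A B :: 'd list bop. A \<in> disk_algebra \<and> B \<in> disk_algebra}"
      by blast
    then obtain Z :: "'d list bop" where Z: "Z \<in> disk_system"
      unfolding disk_system_def by (meson closure_subset subsetD)
    have "scaleC_op 0 o\<^sub>L Z = 0"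
      by (rule blinfun_eqI) (simp add: scaleC_op_apply, transfer, simp)
    moreover have "\<mu> (scaleC_op 0 o\<^sub>L Z) = 0 * \<mu> Z"
      using \<mu> Z unfolding positive_nc_measure_def by blast
    ultimately show ?thesis by simp
  qed
  have prod: "adj (Lshift j o\<^sub>L A) o\<^sub>L (Lshift k o\<^sub>L B) = (if k = j then adj A o\<^sub>L B else 0)"
    if A: "A \<in> disk_algebra" for A B :: "'d list bop" and j k
  proof (rule blinfun_eqI, rule cinner_ext_left)
    fix x y
    note adj = cinner_adj[OF disk_algebra_scaleC]
    have "cinner (blinfun_apply (adj (Lshift j o\<^sub>L A)) (blinfun_apply (Lshift k o\<^sub>L B) x)) y =
        (if k = j then cinner (blinfun_apply B x) (blinfun_apply A y) else 0)"
      by (subst adj[OF disk_algebra_Lshift_compose[OF A]]) (simp add: cinner_Lshift)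
    then show "cinner (blinfun_apply (adj (Lshift j o\<^sub>L A) o\<^sub>L (Lshift k o\<^sub>L B)) x) y =
        cinner (blinfun_apply (if k = j then adj A o\<^sub>L B else 0) x) y"
      by (simp add: adj[OF A] cinner.zero_left)
  qed
  show ?thesis
    unfolding L_Toeplitz_form_def L_invariant_def
    using psd by (simp add: nc_form_def disk_vecs_Lshift prod[OF disk_op_mem] zero)
qed

text \<open>By the Toeplitz relation the shifts are isometric in the form norm, so they map approximating
  sequences to approximating sequences; the Toeplitz relation itself passes to the limit.\<close>

lemma L_Toeplitz_form_closure:
  assumes q: "L_Toeplitz_form q" and closure: "is_form_closure q r"
  shows "L_Toeplitz_form r"
proof -
  have psd: "psd_form q" and inv: "\<And>k x. x \<in> fdom q \<Longrightarrow> blinfun_apply (Lshift k) x \<in> fdom q"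
    and toeplitz: "\<And>j k g h. g \<in> fdom q \<Longrightarrow> h \<in> fdom q \<Longrightarrow>
        fval q (blinfun_apply (Lshift j) g) (blinfun_apply (Lshift k) h) = (if k = j then fval q g h else 0)"
    using q by (auto simp: L_Toeplitz_form_def L_invariant_def)
  have r: "closed_form r" and ext: "form_extends r q" using closure by (auto simp: is_form_closure_def)
  have psd_r: "psd_form r" using r by (simp add: closed_form_def)
  interpret P: hilbert_form "fdom r" "form_inner r"
    using r by (simp add: closed_form_iff_hilbert_form)
  have sub: "x \<in> fdom r" if "x \<in> fdom q" for x using that ext by (auto simp: form_extends_def)
  have toeplitz_inner: "form_inner r (blinfun_apply (Lshift j) g) (blinfun_apply (Lshift k) h) =
      (if k = j then form_inner r g h else 0)" if "g \<in> fdom q" "h \<in> fdom q" for j k g h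
    using that ext inv toeplitz[OF that] by (simp add: form_inner_def form_extends_def cinner_Lshift)
  have shift: "blinfun_apply (Lshift k) x \<in> fdom r \<and>
      P.plim (\<lambda>n. blinfun_apply (Lshift k) (X n)) (blinfun_apply (Lshift k) x)"
    if X: "\<And>n. X n \<in> fdom q" and x: "x \<in> fdom r" and lim: "P.plim X x" for k X x
  proof -
    have XD: "X n \<in> fdom r" for n by (rule sub[OF X])
    have LX: "blinfun_apply (Lshift k) (X n) \<in> fdom r" for n by (rule sub[OF inv[OF X]])
    have "P.pn (blinfun_apply (Lshift k) (X m) - blinfun_apply (Lshift k) (X n)) = P.pn (X m - X n)" for m n
      using csubspace_diff[OF psd_csubspace[OF psd] X X, of m n]
      by (simp add: P.pn_def toeplitz_inner flip: blinfun.diff_right)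
    then have "P.pcauchy (\<lambda>n. blinfun_apply (Lshift k) (X n))"
      using P.plim_pcauchy[OF XD x lim] by (simp add: P.pcauchy_def)
    then obtain y where y: "y \<in> fdom r" and limy: "P.plim (\<lambda>n. blinfun_apply (Lshift k) (X n)) y"
      using P.pcauchy_plim[of "\<lambda>n. blinfun_apply (Lshift k) (X n)"] LX by blast
    have "(\<lambda>n. blinfun_apply (Lshift k) (X n)) \<longlonglongrightarrow> blinfun_apply (Lshift k) x"
      by (intro blinfun.tendsto tendsto_const P.plim_norm[OF XD x lim])
    then have "y = blinfun_apply (Lshift k) x"
      using LIMSEQ_unique[OF P.plim_norm[OF LX y limy]] by blast
    then show ?thesis using y limy by simp
  qed
  have "blinfun_apply (Lshift k) x \<in> fdom r" if x: "x \<in> fdom r" for k x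
    using form_closure_approx[OF closure psd x] shift[OF _ x] by blast
  moreover have "fval r (blinfun_apply (Lshift j) g) (blinfun_apply (Lshift k) h) =
      (if k = j then fval r g h else 0)" if g: "g \<in> fdom r" and h: "h \<in> fdom r" for j k g h
  proof -
    obtain X where X: "\<And>n. X n \<in> fdom q" and limX: "P.plim X g"
      using form_closure_approx[OF closure psd g] by blast
    obtain Y where Y: "\<And>n. Y n \<in> fdom q" and limY: "P.plim Y h"
      using form_closure_approx[OF closure psd h] by blast
    note X' = shift[OF X g limX, of j] and Y' = shift[OF Y h limY, of k]
    have "(\<lambda>n. form_inner r (blinfun_apply (Lshift j) (X n)) (blinfun_apply (Lshift k) (Y n)))
        \<longlonglongrightarrow> form_inner r (blinfun_apply (Lshift j) g) (blinfun_apply (Lshift k) h)"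
      using X Y by (intro P.tendsto_p sub inv X'[THEN conjunct1] X'[THEN conjunct2]
          Y'[THEN conjunct1] Y'[THEN conjunct2])
    moreover have "(\<lambda>n. if k = j then form_inner r (X n) (Y n) else 0)
        \<longlonglongrightarrow> (if k = j then form_inner r g h else 0)"
      using P.tendsto_p[OF sub[OF X] g limX sub[OF Y] h limY] by simp
    ultimately have "form_inner r (blinfun_apply (Lshift j) g) (blinfun_apply (Lshift k) h) =
        (if k = j then form_inner r g h else 0)"
      unfolding toeplitz_inner[OF X Y] by (rule LIMSEQ_unique)
    then show ?thesis by (simp add: form_inner_def cinner_Lshift split: if_splits)
  qed
  ultimately show ?thesis
    using psd_r by (simp add: L_Toeplitz_form_def L_invariant_def)
qed

theorem theorem5p7:
  fixes \<mu> :: "'d::finite list bop \<Rightarrow> complex"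
  assumes "positive_nc_measure \<mu>" and "absolutely_continuous_nc \<mu>"
  shows "L_Toeplitz_form (nc_form \<mu>) \<and>
    (\<exists>T. L_Toeplitz_uop T \<and> is_form_closure (nc_form \<mu>) (form_of_uop T) \<and>
         (\<forall>T'. L_Toeplitz_uop T' \<and> is_form_closure (nc_form \<mu>) (form_of_uop T') \<longrightarrow> T' = T) \<and>
         is_core disk_vecs (uop_sqrt T))"
proof -
  let ?q = "nc_form \<mu>"
  have closable: "closable_form ?q" using assms(2) by (simp add: absolutely_continuous_nc_def)
  then have psd: "psd_form ?q" by (simp add: closable_form_def)
  have toeplitz: "L_Toeplitz_form ?q" by (rule L_Toeplitz_nc_form[OF assms(1) psd])
  obtain r where r: "is_form_closure ?q r" using form_closure_exists[OF closable] by blast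
  then have "closed_form r" by (simp add: is_form_closure_def)
  then obtain T where T: "positive_selfadjoint T"
    and ext: "form_extends (form_of_uop T) r" "form_extends r (form_of_uop T)"
    using closed_form_representation by blast
  have closure: "is_form_closure ?q (form_of_uop T)"
    by (rule form_closure_mutual_extension[OF r ext])
  have toeplitz_T: "L_Toeplitz_form (form_of_uop T)"
    by (rule L_Toeplitz_form_closure[OF toeplitz closure])
  have "L_invariant (Domain (uop_sqrt T))"
    using toeplitz_T by (simp add: L_Toeplitz_form_def form_of_uop_def)
  then have "L_Toeplitz_uop T"
    using T toeplitz_T by (simp add: L_Toeplitz_uop_def)
  moreover have "T' = T" if "L_Toeplitz_uop T'" "is_form_closure ?q (form_of_uop T')" for T'
    using that form_closure_operator_unique[OF T closure] by (simp add: L_Toeplitz_uop_def)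
  moreover have "is_core disk_vecs (uop_sqrt T)"
    using form_closure_core[OF T closure psd] by (simp add: nc_form_def)
  ultimately show ?thesis using toeplitz closure by blast
qed

end
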